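(* Consider the input-output system $$\begin{aligned}\hat z_{t+1}&=(\hat A_0-\hat\Lambda_m\otimes GC)\hat z_t-(\hat\Upsilon\otimes G)\hat\eta_t+\hat B\hat\nu_t,\\ \hat w_t&=\hat C\hat z_t,\qquad \hat\omega_t=(\hat\Upsilon^\top\otimes C)\hat z_t,\\ \hat\nu_t&=\hat\Sigma_1^{-1}\hat w_t-\hat\psi_t,\qquad \hat\eta_t=(\Xi(t)\otimes I_m)\hat\omega_t,\end{aligned}$$ where $\Xi(t)=\mathrm{diag}\{\xi_1(t),\dots,\xi_q(t)\}$, $E[\xi_k(t)]=0$, $E[\xi_k(t)^2]=\sigma^2$ for all $k$, and $\hat\Upsilon=[\hat\ell_1\;\hat\ell_2\;\cdots\;\hat\ell_q]$. Let $F:=\hat A_0-\hat\Lambda_m\otimes GC$. The system is mean square exponentially stable if $$1>\sigma^2\rho(M)^2,$$ where $$M=\begin{bmatrix}\hat S^{-\frac12}A_{\alpha_1}\left(\hat T-F^\top\hat S^{-1}F\right)^{-\frac12}\\ \vdots\\ \hat S^{-\frac12}A_{\alpha_q}\left(\hat T-F^\top\hat S^{-1}F\right)^{-\frac12}\end{bmatrix},\qquad \hat S=\mathcal P^{-1}-\hat B\hat\Sigma_1^{-1}\hat B^\top,\quad \hat T=\mathcal P-\hat C^\top\hat\Sigma_1^{-1}\hat C,$$ $\rho(M)$ is the largest singular value of $M$, and $\mathcal P\in\mathbb{R}^{(N-1)n\times(N-1)n}$ is some symmetric positive definite matrix for which $\hat\Sigma_1-\hat B^\top\mathcal P\hat B>0$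 and $\hat S$ and $\hat T-F^\top\hat S^{-1}F$ are positive definite.
   Context: The system arises from a network of $N$ identical subsystems with states $x^k_t\in\mathbb{R}^n$, outputs $y^k_t=Cx^k_t\in\mathbb{R}^m$; $A\in\mathbb{R}^{n\times n}$, $B\in\mathbb{R}^{n\times m}$, $C\in\mathbb{R}^{m\times n}$, $G\in\mathbb{R}^{n\times m}$. Stacked variables $\tilde x_t=[(x^1_t)^\top\cdots(x^N_t)^\top]^\top$, $\tilde y_t=(I_N\otimes C)\tilde x_t$, $\tilde\phi(\tilde y_t)=[\phi(y^1_t,t)^\top\cdots\phi(y^N_t,t)^\top]^\top$ satisfy $$\tilde x_{t+1}=\left(I_N\otimes A-L_g(\Xi)\otimes GC\right)\tilde x_t-(I_N\otimes B)\tilde\phi(\tilde y_t)$$ (no additive noise). Nonlinearity: $\phi(\cdot,t):\mathbb{R}^m\to\mathbb{R}^m$ is globally Lipschitz, $C^1$ and monotonically nondecreasing; for some $D\in\mathbb{R}^{m\times m}$, $\phi(y,t)^\top(y-D\phi(y,t))>0$ for $y\ne0$ (and $\ge0$ at $y=0$); and for some $D_1\in\mathbb{R}^{m\times m}$ with $\Sigma_1=D_1+D_1^\top>0$, $(\phi(y,t)-\phi(y',t))^\top\left((y-y')-D_1(\phi(y,t)-\phi(y',t))\right)>0$ for $y\neq y'$. Network: undirected graph with mean weights $\mu_{ij}=\mu_{ji}$ and a set $E_U=\{\alpha_1,\dots,\alpha_q\}$ of uncertain links. Link $\alpha_k$, joining nodes $i$ and $j$, has weight $\mu_{ij}+\xi_k(t)$,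 where the $\xi_k(t)$ are zero-mean i.i.d. (in time), mutually independent, all of variance $\sigma^2$. $L_g(\Xi)=L_m+\sum_{k=1}^q\xi_k\ell_k\ell_k^\top$, where $L_m$ is the nominal Laplacian (off-diagonal entries $-\mu_{ij}$, zero row sums) and $\ell_k\in\mathbb{R}^N$ has entry $1$ at $i$, $-1$ at $j$, $0$ elsewhere. $L_m=V_m\Lambda_mV_m^\top$ with $\Lambda_m$ diagonal and $V_m=[\mathbf 1/\sqrt N\;\;U_m]$ orthogonal; $\hat\Lambda_m=U_m^\top L_mU_m$, $\hat\ell_k=U_m^\top\ell_k$, $A_{\alpha_k}=\hat\ell_k\hat\ell_k^\top\otimes GC$. $\hat z_t=(U_m^\top\otimes I_n)\tilde x_t$, $\hat\psi_t=(U_m^\top\otimes I_m)\tilde\phi(\tilde y_t)$, $\hat A_0=I_{N-1}\otimes(A-B\Sigma_1^{-1}C)$, $\hat B=I_{N-1}\otimes B$, $\hat C=I_{N-1}\otimes C$, $\hat\Sigma_1=I_{N-1}\otimes\Sigma_1$. Mean square exponential stability: there exist $K>0$ and $0<\beta<1$ such that $E\|\hat z_t\|^2\le K\beta^t\|\hat z_0\|^2$ for all $t$ and all initial conditions. *)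

theory Defs
  imports "HOL-Probability.Probability"
begin

text \<open>Stacked vectors and Kronecker products are indexed by product types: the entry
  \<open>(k, i)\<close> of a stacked vector is the \<open>i\<close>-th coordinate of its \<open>k\<close>-th block.\<close>

definition kron :: "real^'b^'a \<Rightarrow> real^'d^'c \<Rightarrow> real^('b \<times> 'd)^('a \<times> 'c)" where
  "kron X Y = (\<chi> p r. X $ fst p $ fst r * Y $ snd p $ snd r)"

definition outer :: "real^'a \<Rightarrow> real^'b \<Rightarrow> real^'b^'a" where
  "outer u v = (\<chi> i j. u $ i * v $ j)"

definition diag_mat :: "('a \<Rightarrow> real) \<Rightarrow> real^'a^'a" where
  "diag_mat d = (\<chi> i j. if i = j then d i else 0)"

definition pos_def :: "real^'a^'a \<Rightarrow> bool" where
  "pos_def X \<longleftrightarrow> transpose X = X \<and> (\<forall>v. v \<noteq> 0 \<longrightarrow> v \<bullet> (X *v v) > 0)"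

definition pos_semidef :: "real^'a^'a \<Rightarrow> bool" where
  "pos_semidef X \<longleftrightarrow> transpose X = X \<and> (\<forall>v. v \<bullet> (X *v v) \<ge> 0)"

definition mat_sqrt :: "real^'a^'a \<Rightarrow> real^'a^'a" where
  "mat_sqrt X = (THE R. pos_semidef R \<and> R ** R = X)"

definition mat_inv_sqrt :: "real^'a^'a \<Rightarrow> real^'a^'a" where
  "mat_inv_sqrt X = matrix_inv (mat_sqrt X)"

text \<open>Singular values are the square roots of the eigenvalues of \<open>X\<^sup>T X\<close>. When \<open>X\<close> has fewer
  rows than columns this set may contain an additional \<open>0\<close>, which does not affect the largest
  element.\<close>

definition singular_values :: "real^'b^'a \<Rightarrow> real set" where
  "singular_values X =
     {s. s \<ge> 0 \<and> (\<exists>v. v \<noteq> 0 \<and> (transpose X ** X) *v v = s\<^sup>2 *\<^sub>R v)}"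

definition max_singular_value :: "real^'b^'a \<Rightarrow> real" where
  "max_singular_value X = Max (singular_values X)"

definition C1_map :: "('a::real_normed_vector \<Rightarrow> 'b::real_normed_vector) \<Rightarrow> bool" where
  "C1_map f \<longleftrightarrow>
     (\<exists>J. (\<forall>y. (f has_derivative blinfun_apply (J y)) (at y)) \<and> continuous_on UNIV J)"

text \<open>Monotonicity of a map of \<open>\<real>\<^sup>m\<close> into itself is taken with respect to the inner product.\<close>

definition monotone_map_inner :: "('a::real_inner \<Rightarrow> 'a) \<Rightarrow> bool" where
  "monotone_map_inner f \<longleftrightarrow> (\<forall>y y'. (f y - f y') \<bullet> (y - y') \<ge> 0)"

definition admissible_nonlinearity ::
  "(real^'m \<Rightarrow> nat \<Rightarrow> real^'m) \<Rightarrow> real^'m^'m \<Rightarrow> real^'m^'m \<Rightarrow> bool" where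
  "admissible_nonlinearity \<phi> D D1 \<longleftrightarrow>
     (\<forall>t. (\<exists>L. L-lipschitz_on UNIV (\<lambda>y. \<phi> y t)) \<and> C1_map (\<lambda>y. \<phi> y t) \<and>
          monotone_map_inner (\<lambda>y. \<phi> y t)) \<and>
     (\<forall>t y. y \<noteq> 0 \<longrightarrow> \<phi> y t \<bullet> (y - D *v \<phi> y t) > 0) \<and>
     (\<forall>t. \<phi> 0 t \<bullet> (0 - D *v \<phi> 0 t) \<ge> 0) \<and>
     (\<forall>t y y'. y \<noteq> y' \<longrightarrow>
        (\<phi> y t - \<phi> y' t) \<bullet> ((y - y') - D1 *v (\<phi> y t - \<phi> y' t)) > 0)"

definition stacked_map ::
  "(real^'m \<Rightarrow> nat \<Rightarrow> real^'m) \<Rightarrow> nat \<Rightarrow> real^('v::finite \<times> 'm) \<Rightarrow> real^('v \<times> 'm)" where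
  "stacked_map \<phi> t y = (\<chi> p. \<phi> (\<chi> j. y $ (fst p, j)) t $ snd p)"

definition nominal_laplacian :: "('v \<Rightarrow> 'v \<Rightarrow> real) \<Rightarrow> real^'v^'v" where
  "nominal_laplacian \<mu> = (\<chi> i j. if i = j then (\<Sum>l\<in>UNIV - {i}. \<mu> i l) else - \<mu> i j)"

definition link_vec :: "'v \<Rightarrow> 'v \<Rightarrow> real^'v" where
  "link_vec i j = axis i 1 - axis j 1"

text \<open>The uncertain link \<open>k\<close> joins the nodes \<open>src k\<close> and \<open>dst k\<close>; the graph is undirected, so the
  choice of orientation is immaterial.\<close>

definition uncertain_laplacian ::
  "('v \<Rightarrow> 'v \<Rightarrow> real) \<Rightarrow> ('q \<Rightarrow> 'v) \<Rightarrow> ('q \<Rightarrow> 'v) \<Rightarrow> ('q::finite \<Rightarrow> real) \<Rightarrow> real^'v^'v" where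
  "uncertain_laplacian \<mu> src dst \<xi> =
     nominal_laplacian \<mu> +
     (\<Sum>k\<in>UNIV. \<xi> k *\<^sub>R outer (link_vec (src k) (dst k)) (link_vec (src k) (dst k)))"

definition network :: "('v \<Rightarrow> 'v \<Rightarrow> real) \<Rightarrow> ('q \<Rightarrow> 'v) \<Rightarrow> ('q \<Rightarrow> 'v) \<Rightarrow> bool" where
  "network \<mu> src dst \<longleftrightarrow>
     (\<forall>i j. \<mu> i j = \<mu> j i) \<and> (\<forall>k. src k \<noteq> dst k) \<and> inj (\<lambda>k. {src k, dst k})"

text \<open>The index type \<open>'r\<close> plays the role of \<open>{1..N - 1}\<close>; the columns of \<open>V\<^sub>m = [1/\<surd>N  U\<^sub>m]\<close> are
  indexed by \<open>'r option\<close>, with \<open>None\<close> for the first one.\<close>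

definition V_mat :: "real^'r^'v \<Rightarrow> real^('r option)^'v" where
  "V_mat U = (\<chi> i c. case c of None \<Rightarrow> 1 / sqrt (real CARD('v)) | Some r \<Rightarrow> U $ i $ r)"

definition laplacian_eigenbasis :: "('v \<Rightarrow> 'v \<Rightarrow> real) \<Rightarrow> real^'r^'v \<Rightarrow> bool" where
  "laplacian_eigenbasis \<mu> U \<longleftrightarrow>
     CARD('v) = CARD('r) + 1 \<and>
     transpose (V_mat U) ** V_mat U = mat 1 \<and> V_mat U ** transpose (V_mat U) = mat 1 \<and>
     (\<exists>d. nominal_laplacian \<mu> = V_mat U ** diag_mat d ** transpose (V_mat U))"

definition link_noise :: "'w measure \<Rightarrow> ('q \<Rightarrow> nat \<Rightarrow> 'w \<Rightarrow> real) \<Rightarrow> real \<Rightarrow> bool" where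
  "link_noise W \<xi> \<sigma> \<longleftrightarrow>
     prob_space W \<and>
     prob_space.indep_vars W (\<lambda>_. borel) (\<lambda>(k, t). \<xi> k t) UNIV \<and>
     (\<forall>k t. distr W borel (\<xi> k t) = distr W borel (\<xi> k 0)) \<and>
     (\<forall>k t. integrable W (\<lambda>w. (\<xi> k t w)\<^sup>2) \<and>
            integral\<^sup>L W (\<xi> k t) = 0 \<and> integral\<^sup>L W (\<lambda>w. (\<xi> k t w)\<^sup>2) = \<sigma>\<^sup>2)"

definition network_trajectory ::
  "'w measure \<Rightarrow> real^'n^'n \<Rightarrow> real^'m^'n \<Rightarrow> real^'n^'m \<Rightarrow> real^'m^'n \<Rightarrow>
   (real^'m \<Rightarrow> nat \<Rightarrow> real^'m) \<Rightarrow> ('v \<Rightarrow> 'v \<Rightarrow> real) \<Rightarrow> ('q \<Rightarrow> 'v) \<Rightarrow> ('q \<Rightarrow> 'v) \<Rightarrow>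
   ('q::finite \<Rightarrow> nat \<Rightarrow> 'w \<Rightarrow> real) \<Rightarrow> (nat \<Rightarrow> 'w \<Rightarrow> real^('v::finite \<times> 'n)) \<Rightarrow> bool" where
  "network_trajectory W A B C G \<phi> \<mu> src dst \<xi> x \<longleftrightarrow>
     (\<exists>x0. \<forall>w\<in>space W. x 0 w = x0) \<and>
     (\<forall>t. \<forall>w\<in>space W.
        x (Suc t) w =
          (kron (mat 1) A - kron (uncertain_laplacian \<mu> src dst (\<lambda>k. \<xi> k t w)) (G ** C)) *v x t w
          - kron (mat 1) B *v stacked_map \<phi> t (kron (mat 1) C *v x t w))"

definition Lambda_hat :: "('v \<Rightarrow> 'v \<Rightarrow> real) \<Rightarrow> real^'r^'v \<Rightarrow> real^'r^'r" where
  "Lambda_hat \<mu> U = transpose U ** nominal_laplacian \<mu> ** U"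

definition ell_hat :: "real^'r^'v \<Rightarrow> ('q \<Rightarrow> 'v) \<Rightarrow> ('q \<Rightarrow> 'v) \<Rightarrow> 'q \<Rightarrow> real^'r" where
  "ell_hat U src dst k = transpose U *v link_vec (src k) (dst k)"

definition Upsilon_hat :: "real^'r^'v \<Rightarrow> ('q \<Rightarrow> 'v) \<Rightarrow> ('q \<Rightarrow> 'v) \<Rightarrow> real^'q^'r" where
  "Upsilon_hat U src dst = (\<chi> i k. ell_hat U src dst k $ i)"

definition A_link ::
  "real^'n^'m \<Rightarrow> real^'m^'n \<Rightarrow> real^'r^'v \<Rightarrow> ('q \<Rightarrow> 'v) \<Rightarrow> ('q \<Rightarrow> 'v) \<Rightarrow> 'q \<Rightarrow>
   real^('r \<times> 'n)^('r \<times> 'n)" where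
  "A_link C G U src dst k =
     kron (outer (ell_hat U src dst k) (ell_hat U src dst k)) (G ** C)"

definition F_mat ::
  "real^'n^'n \<Rightarrow> real^'m^'n \<Rightarrow> real^'n^'m \<Rightarrow> real^'m^'n \<Rightarrow> real^'m^'m \<Rightarrow>
   ('v \<Rightarrow> 'v \<Rightarrow> real) \<Rightarrow> real^'r^'v \<Rightarrow> real^('r \<times> 'n)^('r \<times> 'n)" where
  "F_mat A B C G \<Sigma>1 \<mu> U =
     kron (mat 1) (A - B ** matrix_inv \<Sigma>1 ** C) - kron (Lambda_hat \<mu> U) (G ** C)"

definition io_system ::
  "'w measure \<Rightarrow> real^'n^'n \<Rightarrow> real^'m^'n \<Rightarrow> real^'n^'m \<Rightarrow> real^'m^'n \<Rightarrow> real^'m^'m \<Rightarrow>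
   ('v \<Rightarrow> 'v \<Rightarrow> real) \<Rightarrow> ('q \<Rightarrow> 'v) \<Rightarrow> ('q \<Rightarrow> 'v) \<Rightarrow> real^'r^'v \<Rightarrow>
   ('q::finite \<Rightarrow> nat \<Rightarrow> 'w \<Rightarrow> real) \<Rightarrow>
   (nat \<Rightarrow> 'w \<Rightarrow> real^('r \<times> 'm)) \<Rightarrow> (nat \<Rightarrow> 'w \<Rightarrow> real^('r \<times> 'n)) \<Rightarrow>
   (nat \<Rightarrow> 'w \<Rightarrow> real^('r \<times> 'm)) \<Rightarrow> (nat \<Rightarrow> 'w \<Rightarrow> real^('q \<times> 'm)) \<Rightarrow>
   (nat \<Rightarrow> 'w \<Rightarrow> real^('r \<times> 'm)) \<Rightarrow> (nat \<Rightarrow> 'w \<Rightarrow> real^('q \<times> 'm)) \<Rightarrow> bool" where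
  "io_system W A B C G \<Sigma>1 \<mu> src dst U \<xi> \<psi> z y \<omega> \<nu> \<eta> \<longleftrightarrow>
     (\<forall>t. \<forall>w\<in>space W.
        z (Suc t) w =
          F_mat A B C G \<Sigma>1 \<mu> U *v z t w
          - kron (Upsilon_hat U src dst) G *v \<eta> t w
          + kron (mat 1) B *v \<nu> t w \<and>
        y t w = kron (mat 1) C *v z t w \<and>
        \<omega> t w = kron (transpose (Upsilon_hat U src dst)) C *v z t w \<and>
        \<nu> t w = matrix_inv (kron (mat 1) \<Sigma>1) *v y t w - \<psi> t w \<and>
        \<eta> t w = kron (diag_mat (\<lambda>k. \<xi> k t w)) (mat 1) *v \<omega> t w)"

text \<open>The state processes \<open>z\<close> of the input-output system in closed loop with the network: the
  signals \<open>z\<close> and \<open>\<psi>\<close> are the projections of a state trajectory \<open>x\<close> of the network and of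
  its stacked nonlinearity, so that \<open>\<psi>\<close> is not a free input.\<close>

definition io_solutions ::
  "'w measure \<Rightarrow> real^'n^'n \<Rightarrow> real^'m^'n \<Rightarrow> real^'n^'m \<Rightarrow> real^'m^'n \<Rightarrow> real^'m^'m \<Rightarrow>
   (real^'m \<Rightarrow> nat \<Rightarrow> real^'m) \<Rightarrow> ('v \<Rightarrow> 'v \<Rightarrow> real) \<Rightarrow> ('q \<Rightarrow> 'v) \<Rightarrow> ('q \<Rightarrow> 'v) \<Rightarrow>
   real^'r^'v \<Rightarrow> ('q::finite \<Rightarrow> nat \<Rightarrow> 'w \<Rightarrow> real) \<Rightarrow> (nat \<Rightarrow> 'w \<Rightarrow> real^('r \<times> 'n)) set" where
  "io_solutions W A B C G \<Sigma>1 \<phi> \<mu> src dst U \<xi> =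
     {z. \<exists>x \<psi> y \<omega> \<nu> \<eta>.
        network_trajectory W A B C G \<phi> \<mu> src dst \<xi> x \<and>
        (\<forall>t. \<forall>w\<in>space W.
           z t w = kron (transpose U) (mat 1) *v x t w \<and>
           \<psi> t w = kron (transpose U) (mat 1) *v
                     stacked_map \<phi> t (kron (mat 1) C *v x t w)) \<and>
        io_system W A B C G \<Sigma>1 \<mu> src dst U \<xi> \<psi> z y \<omega> \<nu> \<eta>}"

text \<open>Integrability is part of the requirement because the integral of a non-integrable function
  is \<open>0\<close>.\<close>

definition mean_square_exp_stable ::
  "'w measure \<Rightarrow> (nat \<Rightarrow> 'w \<Rightarrow> 'a::real_normed_vector) set \<Rightarrow> bool" where
  "mean_square_exp_stable W Z \<longleftrightarrow>
     (\<exists>K \<beta>. K > 0 \<and> 0 < \<beta> \<and> \<beta> < 1 \<and>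
        (\<forall>z\<in>Z. \<forall>z0. (\<forall>w\<in>space W. z 0 w = z0) \<longrightarrow>
           (\<forall>t. integrable W (\<lambda>w. (norm (z t w))\<^sup>2) \<and>
                integral\<^sup>L W (\<lambda>w. (norm (z t w))\<^sup>2) \<le> K * \<beta> ^ t * (norm z0)\<^sup>2)))"

definition S_hat ::
  "real^'m^'n \<Rightarrow> real^'m^'m \<Rightarrow> real^('r::finite \<times> 'n)^('r \<times> 'n) \<Rightarrow> real^('r \<times> 'n)^('r \<times> 'n)" where
  "S_hat B \<Sigma>1 P =
     matrix_inv P - kron (mat 1) B ** matrix_inv (kron (mat 1) \<Sigma>1) ** transpose (kron (mat 1) B)"

definition T_hat ::
  "real^'n^'m \<Rightarrow> real^'m^'m \<Rightarrow> real^('r::finite \<times> 'n)^('r \<times> 'n) \<Rightarrow> real^('r \<times> 'n)^('r \<times> 'n)" where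
  "T_hat C \<Sigma>1 P =
     P - transpose (kron (mat 1) C) ** matrix_inv (kron (mat 1) \<Sigma>1) ** kron (mat 1) C"

definition TF_mat ::
  "real^'n^'n \<Rightarrow> real^'m^'n \<Rightarrow> real^'n^'m \<Rightarrow> real^'m^'n \<Rightarrow> real^'m^'m \<Rightarrow>
   ('v \<Rightarrow> 'v \<Rightarrow> real) \<Rightarrow> real^'r^'v \<Rightarrow> real^('r \<times> 'n)^('r \<times> 'n) \<Rightarrow>
   real^('r \<times> 'n)^('r \<times> 'n)" where
  "TF_mat A B C G \<Sigma>1 \<mu> U P =
     T_hat C \<Sigma>1 P -
     transpose (F_mat A B C G \<Sigma>1 \<mu> U) ** matrix_inv (S_hat B \<Sigma>1 P) ** F_mat A B C G \<Sigma>1 \<mu> U"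

text \<open>The block rows of \<open>M\<close> are indexed by the uncertain links.\<close>

definition M_mat ::
  "real^'n^'n \<Rightarrow> real^'m^'n \<Rightarrow> real^'n^'m \<Rightarrow> real^'m^'n \<Rightarrow> real^'m^'m \<Rightarrow>
   ('v \<Rightarrow> 'v \<Rightarrow> real) \<Rightarrow> ('q \<Rightarrow> 'v) \<Rightarrow> ('q \<Rightarrow> 'v) \<Rightarrow> real^'r^'v \<Rightarrow>
   real^('r \<times> 'n)^('r \<times> 'n) \<Rightarrow> real^('r \<times> 'n)^('q::finite \<times> ('r \<times> 'n))" where
  "M_mat A B C G \<Sigma>1 \<mu> src dst U P =
     (\<chi> p. (mat_inv_sqrt (S_hat B \<Sigma>1 P) ** A_link C G U src dst (fst p) **
             mat_inv_sqrt (TF_mat A B C G \<Sigma>1 \<mu> U P)) $ snd p)"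

end

theory Submission
  imports Defs
begin

text \<open>
  The Lyapunov function is \<open>V(z) = z \<bullet> P z\<close>. One step of the system is \<open>z' = a + B \<nu>\<close> with
  \<open>a = F z - (\<Sum>k. \<xi>\<^sub>k A\<^sub>k z)\<close>, and the nonlinearity enters only through \<open>\<nu>\<close>. The stability argument
  eliminates \<open>\<nu>\<close>, then averages over the noise, then compares the two remaining quadratic forms.

  Eliminating \<open>\<nu>\<close>. The incremental sector condition, applied to each pair of nodes, survives the
  projection by \<open>U\<close>, because \<open>U U\<^sup>T = 1 - 11\<^sup>T/N\<close> turns inner products of projected stacked vectors
  into sums over pairs of nodes (\<open>projected_inner\<close>, \<open>stacked_sector_bound\<close>). In terms of \<open>\<nu>\<close> it
  reads \<open>\<nu> \<bullet> \<Sigma> \<nu> \<le> y \<bullet> \<Sigma>\<^sup>-\<^sup>1 y\<close> for the output \<open>y = C z\<close>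
  (\<open>loop_transformed_sector_bound\<close>). Two applications of Young's inequality give
  \<open>V(a + B \<nu>) \<le> a \<bullet> S\<^sup>-\<^sup>1 a + \<nu> \<bullet> \<Sigma> \<nu>\<close> (\<open>lyapunov_step_bound\<close>). Hence
  \<open>V(z') \<le> a \<bullet> S\<^sup>-\<^sup>1 a + y \<bullet> \<Sigma>\<^sup>-\<^sup>1 y\<close>, which no longer involves the
  nonlinearity.

  Averaging. The state at time \<open>t\<close> is a function of the noise before \<open>t\<close>, hence independent of the
  noise at \<open>t\<close> (\<open>state_independent_of_current_noise\<close>). As the noise is centred and uncorrelated,
  the mean of \<open>a \<bullet> S\<^sup>-\<^sup>1 a\<close> is that of \<open>F z \<bullet> S\<^sup>-\<^sup>1 F z + \<sigma>\<^sup>2 (\<Sum>k. A\<^sub>k z \<bullet> S\<^sup>-\<^sup>1 A\<^sub>k z)\<close>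
  (\<open>multiplicative_noise_second_moment\<close>).

  Comparing. The last sum is \<open>\<parallel>M v\<parallel>\<^sup>2\<close> for \<open>v = (T - F\<^sup>T S\<^sup>-\<^sup>1 F)\<^sup>1\<^sup>/\<^sup>2 z\<close>, so it is at most
  \<open>\<rho>(M)\<^sup>2 z \<bullet> (T - F\<^sup>T S\<^sup>-\<^sup>1 F) z\<close> (\<open>noise_gain_bound\<close>). Since \<open>\<sigma>\<^sup>2 \<rho>(M)\<^sup>2 < 1\<close>, the mean of \<open>V\<close>
  contracts by a fixed factor in each step (\<open>lyapunov_contraction\<close>), and \<open>V\<close> is equivalent to the
  squared norm.

  That matrix square roots and largest singular values behave as expected rests on the spectral
  theorem for real symmetric matrices, obtained here by maximising the quadratic form on spheres of
  invariant subspaces (\<open>symmetric_max_eigenvector\<close>, \<open>symmetric_eigenbasis\<close>).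
\<close>

section \<open>Symmetric matrices\<close>

lemma linear_matrix_continuous_on [continuous_intros]:
  fixes X :: "real^'b^'a"
  assumes "continuous_on S f"
  shows "continuous_on S (\<lambda>x. X *v f x)"
  by (rule continuous_on_compose2[OF linear_continuous_on assms])
     (auto simp: linear_linear)

lemma inner_matrix_vector_left: "x \<bullet> (X *v y) = (transpose X *v x) \<bullet> (y :: real^'b)"
  for X :: "real^'b^'a"
  by (simp add: dot_lmul_matrix)

lemma inner_symmetric_matrix:
  "transpose X = X \<Longrightarrow> x \<bullet> (X *v y) = (X *v x) \<bullet> y" for X :: "real^'a^'a"
  by (metis inner_matrix_vector_left)

lemma matrix_inv_unique:
  fixes X :: "real^'a^'a"
  assumes "X ** Y = mat 1"
  shows "matrix_inv X = Y" "Y ** X = mat 1"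
proof -
  show YX: "Y ** X = mat 1"
    using assms matrix_left_right_inverse by blast
  have "\<exists>Z. X ** Z = mat 1 \<and> Z ** X = mat 1"
    using assms YX by blast
  then have *: "X ** matrix_inv X = mat 1 \<and> matrix_inv X ** X = mat 1"
    unfolding matrix_inv_def by (rule someI_ex)
  show "matrix_inv X = Y"
    by (metis * YX matrix_mul_assoc matrix_mul_lid matrix_mul_rid)
qed

lemma pos_def_inverse:
  fixes X :: "real^'a^'a"
  assumes "pos_def X"
  shows "X ** matrix_inv X = mat 1" "matrix_inv X ** X = mat 1"
    "transpose (matrix_inv X) = matrix_inv X"
proof -
  have "inj ((*v) X)"
  proof (rule injI)
    fix u v assume "X *v u = X *v v"
    then have "X *v (u - v) = 0"
      by (simp add: algebra_simps)
    then have "(u - v) \<bullet> (X *v (u - v)) = 0"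
      by simp
    then show "u = v"
      using assms unfolding pos_def_def by (metis eq_iff_diff_eq_0 less_irrefl)
  qed
  then obtain Y where Y: "Y ** X = mat 1"
    using matrix_left_invertible_injective by blast
  then have XY: "X ** Y = mat 1"
    using matrix_left_right_inverse by blast
  note inv = matrix_inv_unique[OF XY]
  show 1: "X ** matrix_inv X = mat 1" and "matrix_inv X ** X = mat 1"
    using inv XY by simp_all
  have "X ** transpose (matrix_inv X) = transpose (matrix_inv X ** X)"
    using assms unfolding pos_def_def matrix_transpose_mul by simp
  also have "\<dots> = mat 1"
    using inv by simp
  finally show "transpose (matrix_inv X) = matrix_inv X"
    using matrix_inv_unique(1) by metis
qed

text \<open>A zero of a nonnegative quadratic form is a minimum, so the gradient vanishes there; otherwise a
  small step against the gradient would make the form negative.\<close>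

lemma quadratic_form_vanishing_imp_kernel:
  fixes Q :: "real^'a^'a"
  assumes sym: "transpose Q = Q" and S: "subspace S" and QS: "\<And>u. u \<in> S \<Longrightarrow> Q *v u \<in> S"
    and nonneg: "\<And>u. u \<in> S \<Longrightarrow> u \<bullet> (Q *v u) \<ge> 0"
    and v: "v \<in> S" "v \<bullet> (Q *v v) = 0"
  shows "Q *v v = 0"
proof (rule ccontr)
  define w where "w = Q *v v"
  assume "Q *v v \<noteq> 0"
  then have a: "w \<bullet> w > 0"
    by (simp add: w_def)
  define c where "c = w \<bullet> (Q *v w)"
  have w: "w \<in> S"
    using QS v by (simp add: w_def)
  have c: "c \<ge> 0"
    using nonneg[OF w] by (simp add: c_def)
  \<comment> \<open>Along \<open>v - s w\<close> the form equals \<open>s\<^sup>2 c - 2 s (w \<bullet> w)\<close>. Dividing by \<open>c + 1\<close>, not by \<open>c\<close>, makes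
    it negative also when \<open>c = 0\<close>.\<close>
  define s where "s = w \<bullet> w / (c + 1)"
  have "(v - s *\<^sub>R w) \<bullet> (Q *v (v - s *\<^sub>R w)) = s * (s * c) - 2 * (s * (w \<bullet> w))"
    using v(2) inner_symmetric_matrix[OF sym, of v w]
    by (simp add: algebra_simps inner_commute flip: w_def c_def)
  moreover have "v - s *\<^sub>R w \<in> S"
    using S v(1) w by (simp add: subspace_diff subspace_scale)
  ultimately have "s * (s * c) - 2 * (s * (w \<bullet> w)) \<ge> 0"
    using nonneg by metis
  moreover have "s * c < w \<bullet> w" "s > 0"
    using a c by (simp_all add: s_def field_simps)
  ultimately show False
    using a by (smt (verit) mult_less_cancel_left_pos mult_pos_pos)
qed

text \<open>A maximiser \<open>v\<close> of the form on the unit sphere of \<open>S\<close> exists by compactness. With the maximum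
  \<open>c\<close>, the form of \<open>c 1 - X\<close> is nonnegative on \<open>S\<close> and vanishes at \<open>v\<close>, which makes \<open>v\<close> an
  eigenvector. The invariant subspace \<open>S\<close> is a parameter so that the eigenvectors already found can
  be split off.\<close>

lemma symmetric_max_eigenvector:
  fixes X :: "real^'a^'a"
  assumes sym: "transpose X = X" and S: "subspace S" and XS: "\<And>u. u \<in> S \<Longrightarrow> X *v u \<in> S"
    and ne: "S \<noteq> {0}"
  obtains v c where "v \<in> S" "norm v = 1" "X *v v = c *\<^sub>R v"
    "\<And>u. u \<in> S \<Longrightarrow> u \<bullet> (X *v u) \<le> c * (u \<bullet> u)"
proof -
  let ?K = "S \<inter> sphere 0 1"
  obtain x where x: "x \<in> S" "x \<noteq> 0"
    using ne S subspace_0 by blast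
  then have "x /\<^sub>R norm x \<in> ?K"
    using S by (simp add: subspace_scale)
  moreover have "compact ?K"
    by (simp add: closed_Int_compact closed_subspace S)
  moreover have "continuous_on ?K (\<lambda>u. u \<bullet> (X *v u))"
    by (intro continuous_intros)
  ultimately obtain v where v: "v \<in> ?K" and max: "\<And>u. u \<in> ?K \<Longrightarrow> u \<bullet> (X *v u) \<le> v \<bullet> (X *v v)"
    using continuous_attains_sup[of ?K "\<lambda>u. u \<bullet> (X *v u)"] by blast
  define c where "c = v \<bullet> (X *v v)"
  have bound: "u \<bullet> (X *v u) \<le> c * (u \<bullet> u)" if "u \<in> S" for u
  proof (cases "u = 0")
    case False
    have "u /\<^sub>R norm u \<in> ?K"
      using S that False by (simp add: subspace_scale)
    from max[OF this] have "(u \<bullet> (X *v u)) / (norm u * norm u) \<le> c"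
      by (simp add: algebra_simps c_def field_simps)
    then show ?thesis
      using False by (simp add: field_simps power2_norm_eq_inner[symmetric] power2_eq_square)
  qed simp
  define Q where "Q = c *\<^sub>R mat 1 - X"
  have Qv: "Q *v u = c *\<^sub>R u - X *v u" for u
    by (simp add: Q_def algebra_simps flip: scaleR_matrix_vector_assoc)
  have "transpose Q = Q"
    using sym by (simp add: Q_def transpose_def vec_eq_iff mat_def)
  then have "Q *v v = 0"
  proof (rule quadratic_form_vanishing_imp_kernel[OF _ S])
    show "v \<bullet> (Q *v v) = 0"
      using v by (simp add: Qv inner_diff_right flip: c_def power2_norm_eq_inner)
  qed (use v bound XS S in \<open>auto simp: Qv inner_diff_right subspace_diff subspace_scale\<close>)
  then have "X *v v = c *\<^sub>R v"
    by (simp add: Qv)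
  then show thesis
    using that v bound by auto
qed

text \<open>The spectral theorem. The orthogonal complement of an orthonormal set of eigenvectors is invariant,
  so if it is nonzero it contains one more eigenvector; a set of maximal cardinality is therefore a
  basis.\<close>

lemma symmetric_eigenbasis:
  fixes X :: "real^'a^'a"
  assumes sym: "transpose X = X"
  obtains E ev where "finite E" "\<And>e. e \<in> E \<Longrightarrow> X *v e = ev e *\<^sub>R e"
    "\<And>e. e \<in> E \<Longrightarrow> e \<bullet> e = 1" "\<And>e f. e \<in> E \<Longrightarrow> f \<in> E \<Longrightarrow> e \<noteq> f \<Longrightarrow> e \<bullet> f = 0"
    "\<And>x. x = (\<Sum>e\<in>E. (e \<bullet> x) *\<^sub>R e)"
proof -
  define good where "good E \<longleftrightarrow> (\<forall>e\<in>E. norm e = 1 \<and> (\<exists>c. X *v e = c *\<^sub>R e)) \<and> pairwise orthogonal E"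
    for E :: "(real^'a) set"
  have fin: "finite E" "card E < Suc (CARD('a))" if "good E" for E
  proof -
    have "independent E"
      using that by (intro pairwise_orthogonal_independent) (auto simp: good_def)
    from independent_bound[OF this] show "finite E" "card E < Suc (CARD('a))"
      by auto
  qed
  have "good {}"
    by (simp add: good_def)
  then obtain E where E: "good E" and max: "\<And>E'. good E' \<Longrightarrow> card E' \<le> card E"
    using ex_has_greatest_nat[of good "{}" card "Suc (CARD('a))"] fin(2)
    by (metis less_imp_le)
  define S where "S = {x. \<forall>e\<in>E. e \<bullet> x = 0}"
  have S: "subspace S"
    by (auto simp: S_def subspace_def inner_right_distrib)
  have XS: "X *v u \<in> S" if "u \<in> S" for u
    using that E unfolding S_def good_def
    by (auto simp: inner_symmetric_matrix[OF sym])
  have "S = {0}"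
  proof (rule ccontr)
    assume "S \<noteq> {0}"
    from symmetric_max_eigenvector[OF sym S XS this] obtain v c
      where v: "v \<in> S" "norm v = 1" "X *v v = c *\<^sub>R v"
      by metis
    then have "v \<notin> E"
      by (auto simp: S_def)
    have "good (insert v E)"
      using E v by (auto simp: good_def S_def pairwise_insert orthogonal_def inner_commute)
    from max[OF this] show False
      using \<open>v \<notin> E\<close> fin(1)[OF E] by simp
  qed
  have unit: "e \<bullet> e = 1" if "e \<in> E" for e
    using that E by (simp add: good_def flip: power2_norm_eq_inner)
  have orth: "e \<bullet> f = 0" if "e \<in> E" "f \<in> E" "e \<noteq> f" for e f
    using that E by (simp add: good_def pairwise_def orthogonal_def)
  have "x = (\<Sum>e\<in>E. (e \<bullet> x) *\<^sub>R e)" for x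
  proof -
    have "e \<bullet> (\<Sum>f\<in>E. (f \<bullet> x) *\<^sub>R f) = e \<bullet> x" if "e \<in> E" for e
    proof -
      have "e \<bullet> (\<Sum>f\<in>E. (f \<bullet> x) *\<^sub>R f) = (\<Sum>f\<in>E. if f = e then e \<bullet> x else 0)"
        unfolding inner_sum_right using that by (intro sum.cong) (auto simp: unit orth)
      then show ?thesis
        using that fin(1)[OF E] by simp
    qed
    then have "x - (\<Sum>e\<in>E. (e \<bullet> x) *\<^sub>R e) \<in> S"
      by (simp add: S_def inner_diff_right)
    then show ?thesis
      using \<open>S = {0}\<close> by simp
  qed
  moreover obtain ev where "\<And>e. e \<in> E \<Longrightarrow> X *v e = ev e *\<^sub>R e"
    using E unfolding good_def by metis
  ultimately show thesis
    using that fin(1)[OF E] unit orth by blast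
qed

lemma matrix_eqI_eigenbasis:
  fixes R R' :: "real^'a^'a"
  assumes "\<And>x. x = (\<Sum>e\<in>E. (e \<bullet> x) *\<^sub>R e)" "\<And>e. e \<in> E \<Longrightarrow> R *v e = R' *v e"
  shows "R = R'"
proof -
  have *: "Y *v x = (\<Sum>e\<in>E. (e \<bullet> x) *\<^sub>R (Y *v e))" for Y :: "real^'a^'a" and x
    by (subst assms(1)[of x]) (simp add: linear_sum[OF matrix_vector_mul_linear] matrix_vector_mult_scaleR)
  show ?thesis
    unfolding matrix_eq by (subst (1 2) *) (simp add: assms(2))
qed

text \<open>For \<open>u = R e - \<surd>c e\<close> one has \<open>(R + \<surd>c) u = (X - c) e = 0\<close>, and \<open>R + \<surd>c\<close> is injective because
  \<open>R\<close> is positive semidefinite and \<open>c > 0\<close>. For positive definite \<open>X\<close> this determines \<open>R\<close> on an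
  eigenbasis of \<open>X\<close>, which gives the uniqueness of the square root.\<close>

lemma pos_semidef_sqrt_eigenvector:
  fixes R :: "real^'a^'a"
  assumes R: "pos_semidef R" and sq: "R ** R = X" and e: "X *v e = c *\<^sub>R e" and c: "c > 0"
  shows "R *v e = sqrt c *\<^sub>R e"
proof -
  define u where "u = R *v e - sqrt c *\<^sub>R e"
  have "R *v (R *v e) = c *\<^sub>R e"
    using e sq by (simp add: matrix_vector_mul_assoc)
  then have "R *v u = - sqrt c *\<^sub>R u"
    using c by (simp add: u_def algebra_simps)
  then have "u \<bullet> (R *v u) = - sqrt c * (u \<bullet> u)"
    by simp
  moreover have "u \<bullet> (R *v u) \<ge> 0"
    using R by (simp add: pos_semidef_def)
  ultimately have "sqrt c * (u \<bullet> u) \<le> 0"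
    by linarith
  then have "u = 0"
    using c by (metis inner_eq_zero_iff inner_ge_zero mult_le_0_iff not_less order_antisym real_sqrt_gt_zero)
  then show ?thesis
    by (simp add: u_def)
qed

lemma outer_mult_vector: "outer u v *v x = (v \<bullet> x) *\<^sub>R u"
  by (simp add: outer_def matrix_vector_mult_def vec_eq_iff inner_vec_def sum_distrib_left
      sum_distrib_right ac_simps)

text \<open>Justifies the definite description in the definition of \<open>mat_sqrt\<close>. On an
  eigenbasis of \<open>X\<close> the root is diagonal, with the square roots of the eigenvalues as entries.\<close>

lemma mat_sqrt_exists_unique:
  fixes X :: "real^'a^'a"
  assumes X: "pos_def X"
  shows "\<exists>!R. pos_semidef R \<and> R ** R = X"
proof -
  have sym: "transpose X = X"
    using X by (simp add: pos_def_def)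
  obtain E ev where fin: "finite E"
    and ev: "\<And>e. e \<in> E \<Longrightarrow> X *v e = ev e *\<^sub>R e" and unit: "\<And>e. e \<in> E \<Longrightarrow> e \<bullet> e = 1"
    and orth: "\<And>e f. e \<in> E \<Longrightarrow> f \<in> E \<Longrightarrow> e \<noteq> f \<Longrightarrow> e \<bullet> f = 0"
    and expand: "\<And>x. x = (\<Sum>e\<in>E. (e \<bullet> x) *\<^sub>R e)"
    by (rule symmetric_eigenbasis[OF sym]) (rule that, assumption+)
  have pos: "ev e > 0" if "e \<in> E" for e
  proof -
    have "e \<noteq> 0" and "e \<bullet> (X *v e) = ev e"
      using unit[OF that] ev[OF that] by auto
    then show ?thesis
      using X unfolding pos_def_def by metis
  qed
  define R where "R = (\<Sum>e\<in>E. sqrt (ev e) *\<^sub>R outer e e)"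
  have Rv: "R *v x = (\<Sum>e\<in>E. (sqrt (ev e) * (e \<bullet> x)) *\<^sub>R e)" for x
    unfolding R_def using fin
    by (induction) (simp_all add: matrix_vector_mult_add_rdistrib outer_mult_vector
        flip: scaleR_matrix_vector_assoc)
  have Re: "R *v e = sqrt (ev e) *\<^sub>R e" if "e \<in> E" for e
  proof -
    have "R *v e = (\<Sum>f\<in>E. if f = e then sqrt (ev e) *\<^sub>R e else 0)"
      unfolding Rv using that by (intro sum.cong) (auto simp: unit orth)
    then show ?thesis
      using that fin by simp
  qed
  have "transpose R = R"
    by (simp add: R_def transpose_def vec_eq_iff outer_def mult.commute mult.left_commute)
  moreover have "x \<bullet> (R *v x) \<ge> 0" for x
    unfolding Rv inner_sum_right
    by (intro sum_nonneg) (use pos in \<open>auto simp: inner_commute mult.assoc less_imp_le\<close>)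
  ultimately have "pos_semidef R"
    by (simp add: pos_semidef_def)
  moreover have "R ** R = X"
    using expand
    by (rule matrix_eqI_eigenbasis)
       (use pos in \<open>simp add: Re ev matrix_vector_mult_scaleR less_imp_le flip: matrix_vector_mul_assoc\<close>)
  moreover have "R' = R" if "pos_semidef R'" "R' ** R' = X" for R'
    using expand
    by (rule matrix_eqI_eigenbasis)
       (use pos ev pos_semidef_sqrt_eigenvector[OF that] Re in auto)
  ultimately show ?thesis
    by blast
qed

lemma mat_sqrt_pos_def:
  fixes X :: "real^'a^'a"
  assumes "pos_def X"
  shows "transpose (mat_sqrt X) = mat_sqrt X" "mat_sqrt X ** mat_sqrt X = X"
  using theI'[OF mat_sqrt_exists_unique[OF assms]] unfolding mat_sqrt_def pos_semidef_def by auto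

lemma mat_inv_sqrt_pos_def:
  fixes X :: "real^'a^'a"
  assumes X: "pos_def X"
  shows "mat_inv_sqrt X ** mat_sqrt X = mat 1"
    "transpose (mat_inv_sqrt X) = mat_inv_sqrt X"
    "mat_inv_sqrt X ** mat_inv_sqrt X = matrix_inv X"
proof -
  let ?R = "mat_sqrt X"
  have "?R ** (?R ** matrix_inv X) = mat 1"
    using mat_sqrt_pos_def(2)[OF X] pos_def_inverse(1)[OF X] by (simp add: matrix_mul_assoc)
  note inv = matrix_inv_unique[OF this, folded mat_inv_sqrt_def]
  show 1: "mat_inv_sqrt X ** ?R = mat 1"
    using inv by simp
  then have 2: "?R ** mat_inv_sqrt X = mat 1"
    using matrix_left_right_inverse by blast
  have "?R ** transpose (mat_inv_sqrt X) = transpose (mat_inv_sqrt X ** ?R)"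
    by (simp add: matrix_transpose_mul mat_sqrt_pos_def[OF X])
  then have "?R ** transpose (mat_inv_sqrt X) = mat 1"
    using 1 by simp
  from matrix_inv_unique(1)[OF this] show "transpose (mat_inv_sqrt X) = mat_inv_sqrt X"
    by (simp add: mat_inv_sqrt_def)
  have "X ** (mat_inv_sqrt X ** mat_inv_sqrt X) = ?R ** (?R ** mat_inv_sqrt X) ** mat_inv_sqrt X"
    by (metis mat_sqrt_pos_def(2)[OF X] matrix_mul_assoc)
  then have "X ** (mat_inv_sqrt X ** mat_inv_sqrt X) = mat 1"
    by (simp add: 2)
  from matrix_inv_unique(1)[OF this] show "mat_inv_sqrt X ** mat_inv_sqrt X = matrix_inv X"
    by simp
qed

text \<open>Eigenvectors of \<open>X\<^sup>T X\<close> for different eigenvalues are orthogonal, and an orthogonal set in a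
  Euclidean space is finite. Finiteness makes the \<open>Max\<close> in \<open>max_singular_value\<close> meaningful.\<close>

lemma finite_singular_values: "finite (singular_values X)"
proof -
  let ?H = "transpose X ** X"
  have sym: "transpose ?H = ?H"
    by (simp add: matrix_transpose_mul)
  obtain v where v: "\<And>s. s \<in> singular_values X \<Longrightarrow> v s \<noteq> 0 \<and> ?H *v v s = s\<^sup>2 *\<^sub>R v s \<and> s \<ge> 0"
  proof -
    have "\<forall>s\<in>singular_values X. \<exists>v. v \<noteq> 0 \<and> ?H *v v = s\<^sup>2 *\<^sub>R v \<and> s \<ge> 0"
      unfolding singular_values_def by blast
    from bchoice[OF this] show thesis
      using that by blast
  qed
  have orth: "orthogonal (v s) (v t)"
    if s: "s \<in> singular_values X" "t \<in> singular_values X" "s \<noteq> t" for s t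
  proof -
    have "s\<^sup>2 * (v s \<bullet> v t) = t\<^sup>2 * (v s \<bullet> v t)"
      using inner_symmetric_matrix[OF sym, of "v s" "v t"] v s by simp
    moreover have "s\<^sup>2 \<noteq> t\<^sup>2"
      using v s by (metis power2_eq_imp_eq)
    ultimately show ?thesis
      by (simp add: orthogonal_def)
  qed
  have "inj_on v (singular_values X)"
    by (rule inj_onI) (metis orth orthogonal_self v)
  moreover have "finite (v ` singular_values X)"
    by (rule pairwise_orthogonal_imp_finite) (auto simp: pairwise_def intro!: orth)
  ultimately show ?thesis
    using finite_image_iff by blast
qed

lemma norm_matrix_vector_le_max_singular_value:
  fixes X :: "real^'b^'a"
  shows "(norm (X *v u))\<^sup>2 \<le> (max_singular_value X)\<^sup>2 * (norm u)\<^sup>2"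
proof -
  let ?H = "transpose X ** X"
  have form: "x \<bullet> (?H *v x) = (norm (X *v x))\<^sup>2" for x
    unfolding matrix_vector_mul_assoc[symmetric] inner_matrix_vector_left[of x "transpose X"]
    by (simp add: dot_square_norm)
  have "transpose ?H = ?H"
    by (simp add: matrix_transpose_mul)
  moreover have "(UNIV :: (real^'b) set) \<noteq> {0}"
    by (metis UNIV_not_singleton)
  ultimately obtain v c where v: "norm v = 1" "?H *v v = c *\<^sub>R v"
    and max: "\<And>u. u \<bullet> (?H *v u) \<le> c * (u \<bullet> u)"
    using symmetric_max_eigenvector[of ?H UNIV] by auto
  have "c = (norm (X *v v))\<^sup>2"
    using form[of v] v by (simp flip: power2_norm_eq_inner)
  then have c: "c = (sqrt c)\<^sup>2" "sqrt c \<ge> 0"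
    by simp_all
  moreover have "v \<noteq> 0"
    using v by auto
  ultimately have "sqrt c \<in> singular_values X"
    using v unfolding singular_values_def by auto
  then have "sqrt c \<le> max_singular_value X"
    unfolding max_singular_value_def by (rule Max_ge[OF finite_singular_values])
  then have "c \<le> (max_singular_value X)\<^sup>2"
    using c power_mono by metis
  moreover have "(norm (X *v u))\<^sup>2 \<le> c * (norm u)\<^sup>2"
    using max[of u] by (simp add: form power2_norm_eq_inner)
  ultimately show ?thesis
    by (meson mult_right_mono order_trans zero_le_power2)
qed

section \<open>Quadratic inequalities\<close>

lemma pos_def_nonneg: "pos_def X \<Longrightarrow> v \<bullet> (X *v v) \<ge> 0"
  unfolding pos_def_def by (cases "v = 0") (auto intro: less_imp_le)

lemma pos_def_lower_bound:
  fixes X :: "real^'a^'a"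
  assumes X: "pos_def X"
  obtains c where "c > 0" "\<And>v. c * (norm v)\<^sup>2 \<le> v \<bullet> (X *v v)"
proof -
  have sym: "transpose (- X) = - X"
    using X by (simp add: pos_def_def transpose_def vec_eq_iff)
  have neg: "(- X) *v v = - (X *v v)" for v
    by (simp add: matrix_vector_mult_def vec_eq_iff sum_negf)
  have "(UNIV :: (real^'a) set) \<noteq> {0}"
    by (metis UNIV_not_singleton)
  then obtain v c where v: "norm v = 1" "(- X) *v v = c *\<^sub>R v"
    and max: "\<And>u. u \<bullet> ((- X) *v u) \<le> c * (u \<bullet> u)"
    using symmetric_max_eigenvector[OF sym subspace_UNIV] by auto
  have "v \<noteq> 0"
    using v by auto
  then have "v \<bullet> (X *v v) > 0"
    using X by (simp add: pos_def_def)
  moreover have "v \<bullet> ((- X) *v v) = c"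
    using v by (simp flip: power2_norm_eq_inner)
  ultimately have "- c > 0"
    by (simp add: neg)
  moreover have "- c * (norm u)\<^sup>2 \<le> u \<bullet> (X *v u)" for u
    using max[of u] by (simp add: neg power2_norm_eq_inner)
  ultimately show thesis
    using that by blast
qed

lemma quadratic_form_upper_bound:
  fixes X :: "real^'a^'a"
  obtains c where "c > 0" "\<And>v. \<bar>v \<bullet> (X *v v)\<bar> \<le> c * (norm v)\<^sup>2"
proof
  show "onorm ((*v) X) + 1 > 0"
    using onorm_pos_le[of "(*v) X"] by (simp add: linear_linear add_nonneg_pos)
  show "\<bar>v \<bullet> (X *v v)\<bar> \<le> (onorm ((*v) X) + 1) * (norm v)\<^sup>2" for v
  proof -
    have "\<bar>v \<bullet> (X *v v)\<bar> \<le> norm v * norm (X *v v)"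
      by (rule Cauchy_Schwarz_ineq2)
    also have "\<dots> \<le> norm v * (onorm ((*v) X) * norm v)"
      by (intro mult_left_mono onorm) (simp_all add: linear_linear)
    also have "\<dots> \<le> (onorm ((*v) X) + 1) * (norm v)\<^sup>2"
      by (simp add: algebra_simps power2_eq_square)
    finally show ?thesis .
  qed
qed

text \<open>Young's inequality, from \<open>(q - X\<^sup>-\<^sup>1 a) \<bullet> X (q - X\<^sup>-\<^sup>1 a) \<ge> 0\<close>.\<close>

lemma pos_def_young:
  fixes X :: "real^'a^'a"
  assumes X: "pos_def X"
  shows "2 * (q \<bullet> a) \<le> q \<bullet> (X *v q) + a \<bullet> (matrix_inv X *v a)"
proof -
  let ?Y = "matrix_inv X"
  have sym: "transpose X = X"
    using X by (simp add: pos_def_def)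
  have XY: "X *v (?Y *v a) = a"
    by (simp add: matrix_vector_mul_assoc pos_def_inverse[OF X])
  have "0 \<le> (q - ?Y *v a) \<bullet> (X *v (q - ?Y *v a))"
    by (rule pos_def_nonneg[OF X])
  also have "\<dots> = q \<bullet> (X *v q) + a \<bullet> (?Y *v a) - 2 * (q \<bullet> a)"
    using inner_symmetric_matrix[OF sym, of "?Y *v a" q]
    by (simp add: matrix_vector_mult_diff_distrib XY inner_diff_left inner_diff_right inner_commute)
  finally show ?thesis
    by linarith
qed

text \<open>The substitution \<open>\<nu> = X\<^sup>-\<^sup>1 y - \<psi>\<close> centres the sector: the bilinear condition on \<open>\<psi>\<close> and \<open>y\<close>
  becomes a bound on the gain from \<open>y\<close> to \<open>\<nu>\<close>.\<close>

lemma loop_transformed_sector_bound: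
  fixes X :: "real^'m^'m"
  assumes X: "pos_def X" and sector: "\<psi> \<bullet> (X *v \<psi>) \<le> 2 * (\<psi> \<bullet> y)"
  shows "(matrix_inv X *v y - \<psi>) \<bullet> (X *v (matrix_inv X *v y - \<psi>)) \<le> y \<bullet> (matrix_inv X *v y)"
proof -
  define r where "r = matrix_inv X *v y"
  have Xr: "X *v r = y"
    by (simp add: r_def matrix_vector_mul_assoc pos_def_inverse[OF X])
  have "r \<bullet> (X *v \<psi>) = y \<bullet> \<psi>"
    using X Xr by (metis inner_symmetric_matrix pos_def_def)
  then have "(r - \<psi>) \<bullet> (X *v (r - \<psi>)) = y \<bullet> r - 2 * (\<psi> \<bullet> y) + \<psi> \<bullet> (X *v \<psi>)"
    by (simp add: matrix_vector_mult_diff_distrib Xr inner_diff_left inner_diff_right inner_commute)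
  then show ?thesis
    using sector by (simp add: r_def)
qed

text \<open>Removes the input \<open>\<nu>\<close> from the Lyapunov function at the price of the supply term \<open>\<nu> \<bullet> X \<nu>\<close>. The
  matrix \<open>P\<^sup>-\<^sup>1 - B X\<^sup>-\<^sup>1 B\<^sup>T\<close> is what remains of \<open>P\<^sup>-\<^sup>1\<close> after the cross term in \<open>\<nu>\<close> has been absorbed.\<close>

lemma lyapunov_step_bound:
  fixes B :: "real^'m^'n"
  assumes P: "pos_def P" and X: "pos_def X"
    and S: "pos_def (matrix_inv P - B ** matrix_inv X ** transpose B)"
  shows "(a + B *v \<nu>) \<bullet> (P *v (a + B *v \<nu>)) \<le>
    a \<bullet> (matrix_inv (matrix_inv P - B ** matrix_inv X ** transpose B) *v a) + \<nu> \<bullet> (X *v \<nu>)"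
proof -
  let ?S = "matrix_inv P - B ** matrix_inv X ** transpose B"
  let ?u = "a + B *v \<nu>"
  \<comment> \<open>\<open>q\<close> attains the maximum in \<open>u \<bullet> P u = max (2 q \<bullet> u - q \<bullet> P\<^sup>-\<^sup>1 q)\<close>; with this dual
    variable Young's inequality decouples the noise-driven part \<open>a\<close> from the input \<open>\<nu>\<close>.\<close>
  define q where "q = P *v ?u"
  have "matrix_inv P *v q = ?u"
    by (simp add: q_def matrix_vector_mul_assoc pos_def_inverse[OF P])
  then have S_form: "q \<bullet> (?S *v q) = q \<bullet> ?u - (transpose B *v q) \<bullet> (matrix_inv X *v (transpose B *v q))"
    using inner_matrix_vector_left[of q B]
    by (simp add: matrix_vector_mult_diff_rdistrib inner_diff_right matrix_vector_mul_assoc[symmetric]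
        del: transpose_matrix_vector)
  have "2 * (q \<bullet> a) \<le> q \<bullet> (?S *v q) + a \<bullet> (matrix_inv ?S *v a)"
    by (rule pos_def_young[OF S])
  moreover have "2 * (\<nu> \<bullet> (transpose B *v q)) \<le>
      \<nu> \<bullet> (X *v \<nu>) + (transpose B *v q) \<bullet> (matrix_inv X *v (transpose B *v q))"
    by (rule pos_def_young[OF X])
  moreover have "q \<bullet> (B *v \<nu>) = \<nu> \<bullet> (transpose B *v q)"
    using inner_matrix_vector_left[of q B \<nu>] by (simp add: inner_commute)
  ultimately have "q \<bullet> ?u \<le> a \<bullet> (matrix_inv ?S *v a) + \<nu> \<bullet> (X *v \<nu>)"
    unfolding S_form by (simp only: inner_add_right)
  then show ?thesis
    by (simp add: q_def inner_commute)
qed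

section \<open>Kronecker products and the projected sector condition\<close>

lemma sum_UNIV_prod:
  "(\<Sum>p\<in>(UNIV :: ('a::finite \<times> 'b::finite) set). f p) = (\<Sum>i\<in>UNIV. \<Sum>j\<in>UNIV. f (i, j))"
  unfolding UNIV_Times_UNIV[symmetric] sum.cartesian_product by simp

lemma kron_mult: "kron X Y ** kron X' Y' = kron (X ** X') (Y ** Y')"
  by (simp add: kron_def matrix_matrix_mult_def vec_eq_iff sum_UNIV_prod sum_product ac_simps)

lemma transpose_kron: "transpose (kron X Y) = kron (transpose X) (transpose Y)"
  by (simp add: kron_def transpose_def vec_eq_iff)

lemma kron_add_left: "kron (X + X') Y = kron X Y + kron X' Y"
  by (simp add: kron_def vec_eq_iff algebra_simps)

lemma kron_sum_scaleR_left: "kron (\<Sum>k\<in>K. c k *\<^sub>R X k) Y = (\<Sum>k\<in>K. c k *\<^sub>R kron (X k) Y)"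
  by (simp add: kron_def vec_eq_iff sum_distrib_right mult.assoc)

definition block :: "real^('a::finite \<times> 'b::finite) \<Rightarrow> 'a \<Rightarrow> real^'b" where
  "block y i = (\<chi> j. y $ (i, j))"

lemma inner_blocks: "x \<bullet> y = (\<Sum>i\<in>UNIV. block x i \<bullet> block y i)"
  by (simp add: block_def inner_vec_def sum_UNIV_prod)

lemma block_kron: "block (kron X Y *v y) i = Y *v (\<Sum>l\<in>UNIV. X $ i $ l *\<^sub>R block y l)"
  unfolding vec_eq_iff
proof
  fix j
  have "block (kron X Y *v y) i $ j = (\<Sum>l\<in>UNIV. \<Sum>k\<in>UNIV. X $ i $ l * Y $ j $ k * y $ (l, k))"
    by (simp add: block_def kron_def matrix_vector_mult_def sum_UNIV_prod)
  also have "\<dots> = (\<Sum>k\<in>UNIV. \<Sum>l\<in>UNIV. X $ i $ l * Y $ j $ k * y $ (l, k))"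
    by (rule sum.swap)
  also have "\<dots> = (Y *v (\<Sum>l\<in>UNIV. X $ i $ l *\<^sub>R block y l)) $ j"
    by (simp add: block_def matrix_vector_mult_def sum_distrib_left mult.commute mult.left_commute)
  finally show "block (kron X Y *v y) i $ j = (Y *v (\<Sum>l\<in>UNIV. X $ i $ l *\<^sub>R block y l)) $ j" .
qed
  
lemma block_eq_iff: "x = y \<longleftrightarrow> (\<forall>i. block x i = block y i)"
  by (auto simp: block_def vec_eq_iff)

lemma block_kron_mat_1: "block (kron (mat 1) Y *v y) i = Y *v block y i"
  by (simp add: block_kron mat_def if_distrib if_distribR sum.delta cong: if_cong)

lemma block_stacked_map: "block (stacked_map \<phi> t y) i = \<phi> (block y i) t"
  by (simp add: block_def stacked_map_def)

lemma pos_def_kron_mat_1: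
  fixes Y :: "real^'b::finite^'b"
  assumes "pos_def Y"
  shows "pos_def (kron (mat 1) Y :: real^('a::finite \<times> 'b)^('a \<times> 'b))"
  unfolding pos_def_def
proof (intro conjI allI impI)
  show "transpose (kron (mat 1) Y) = (kron (mat 1) Y :: real^('a \<times> 'b)^('a \<times> 'b))"
    using assms by (simp add: transpose_kron pos_def_def)
  fix v :: "real^('a \<times> 'b)" assume "v \<noteq> 0"
  then obtain i where i: "block v i \<noteq> 0"
    by (auto simp: vec_eq_iff block_def)
  have "b \<bullet> (Y *v b) \<ge> 0" for b
    using assms unfolding pos_def_def by (cases "b = 0") (auto intro: less_imp_le)
  moreover have "block v i \<bullet> (Y *v block v i) > 0"
    using assms i unfolding pos_def_def by blast
  ultimately show "v \<bullet> (kron (mat 1) Y *v v) > 0"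
    unfolding inner_blocks[of v] block_kron_mat_1 by (intro sum_pos2[of _ i]) auto
qed

text \<open>Read off from \<open>V V\<^sup>T = 1\<close> by separating the column \<open>1/\<surd>N\<close> of \<open>V\<close>.\<close>

lemma eigenbasis_projector:
  fixes U :: "real^'r::finite^'v::finite"
  assumes "laplacian_eigenbasis \<mu> U"
  shows "(U ** transpose U) $ i $ j = (if i = j then 1 else 0) - 1 / real CARD('v)"
proof -
  have "(V_mat U ** transpose (V_mat U)) $ i $ j = (mat 1 :: real^'v^'v) $ i $ j"
    using assms by (simp add: laplacian_eigenbasis_def)
  then show ?thesis
    by (simp add: V_mat_def matrix_matrix_mult_def transpose_def mat_def UNIV_option_conv
        sum.reindex split: if_splits)
qed

text \<open>The projector \<open>1 - 11\<^sup>T/N\<close> is the Laplacian of the complete graph up to the factor \<open>1/N\<close>, so the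
  inner product only sees differences between nodes. This is what lets an incremental condition on
  \<open>\<phi>\<close> act on projected signals.\<close>

lemma projected_inner:
  fixes U :: "real^'r::finite^'v::finite" and x y :: "real^('v \<times> 'm::finite)"
  assumes "laplacian_eigenbasis \<mu> U"
  shows "(kron (transpose U) (mat 1) *v x) \<bullet> (kron (transpose U) (mat 1) *v y) =
    1 / (2 * real CARD('v)) * (\<Sum>i\<in>UNIV. \<Sum>j\<in>UNIV. (block x i - block x j) \<bullet> (block y i - block y j))"
proof -
  let ?N = "real CARD('v)"
  let ?K = "kron (transpose U) (mat 1) :: real^('v \<times> 'm)^('r \<times> 'm)"
  have N: "?N > 0"
    by simp
  have "(?K *v x) \<bullet> (?K *v y) = x \<bullet> (kron (U ** transpose U) (mat 1) *v y)"
    using inner_matrix_vector_left[of x "transpose ?K" "?K *v y"]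
    by (simp add: matrix_vector_mul_assoc transpose_kron kron_mult del: transpose_matrix_vector)
  also have "\<dots> = (\<Sum>i\<in>UNIV. block x i \<bullet> (\<Sum>l\<in>UNIV. ((if i = l then 1 else 0) - 1 / ?N) *\<^sub>R block y l))"
    unfolding inner_blocks[of x] block_kron eigenbasis_projector[OF assms] by simp
  also have "\<dots> = (\<Sum>i\<in>UNIV. block x i \<bullet> (block y i - (1 / ?N) *\<^sub>R (\<Sum>l\<in>UNIV. block y l)))"
  proof -
    have "(\<Sum>l\<in>UNIV. (if i = l then 1 else 0) *\<^sub>R block y l) = (\<Sum>l\<in>UNIV. if i = l then block y l else 0)"
      for i by (intro sum.cong) auto
    then show ?thesis
      by (simp add: scaleR_diff_left sum_subtractf flip: scaleR_sum_right)
  qed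
  also have "\<dots> = (\<Sum>i\<in>UNIV. block x i \<bullet> block y i) -
      1 / ?N * ((\<Sum>i\<in>UNIV. block x i) \<bullet> (\<Sum>i\<in>UNIV. block y i))"
    by (simp add: inner_diff_right sum_subtractf inner_sum_left sum_divide_distrib)
  also have "\<dots> = 1 / (2 * ?N) *
      (2 * ?N * (\<Sum>i\<in>UNIV. block x i \<bullet> block y i) - 2 * ((\<Sum>i\<in>UNIV. block x i) \<bullet> (\<Sum>i\<in>UNIV. block y i)))"
    using N by (simp add: field_simps)
  also have "2 * ?N * (\<Sum>i\<in>UNIV. block x i \<bullet> block y i) -
      2 * ((\<Sum>i\<in>UNIV. block x i) \<bullet> (\<Sum>i\<in>UNIV. block y i)) =
    (\<Sum>i\<in>UNIV. \<Sum>j\<in>UNIV. (block x i - block x j) \<bullet> (block y i - block y j))"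
    by (simp add: inner_diff_left inner_diff_right sum_subtractf sum.distrib
        inner_sum_left[symmetric] inner_sum_right[symmetric] sum_distrib_left[symmetric])
  finally show ?thesis .
qed

text \<open>The sum over all pairs of nodes of the incremental sector condition. The inner product with
  \<open>D\<^sub>1 d\<close> sees only the symmetric part of \<open>D\<^sub>1\<close>, which is \<open>\<Sigma>\<^sub>1 / 2\<close>.\<close>

lemma stacked_sector_bound:
  fixes U :: "real^'r::finite^'v::finite"
  assumes S1: "\<Sigma>1 = D1 + transpose D1"
    and adm: "admissible_nonlinearity \<phi> D D1" and basis: "laplacian_eigenbasis \<mu> U"
    and \<psi>: "\<psi> = kron (transpose U) (mat 1) *v stacked_map \<phi> t y"
    and w: "w = kron (transpose U) (mat 1) *v y"
  shows "2 * (\<psi> \<bullet> w) \<ge> \<psi> \<bullet> (kron (mat 1) \<Sigma>1 *v \<psi>)"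
proof -
  let ?f = "stacked_map \<phi> t y"
  have sector: "2 * (d \<bullet> (block y i - block y j)) \<ge> d \<bullet> (\<Sigma>1 *v d)"
    if d: "d = \<phi> (block y i) t - \<phi> (block y j) t" for d i j
  proof (cases "block y i = block y j")
    case False
    then have "d \<bullet> ((block y i - block y j) - D1 *v d) > 0"
      using adm d unfolding admissible_nonlinearity_def by blast
    moreover have "d \<bullet> (transpose D1 *v d) = d \<bullet> (D1 *v d)"
      using inner_matrix_vector_left[of d D1 d] by (simp add: inner_commute)
    ultimately show ?thesis
      by (simp add: S1 matrix_vector_mult_add_rdistrib inner_diff_right inner_add_right del: transpose_matrix_vector)
  qed (simp add: d)
  have "kron (mat 1) \<Sigma>1 *v \<psi> = kron (transpose U) (mat 1) *v (kron (mat 1) \<Sigma>1 *v ?f)"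
    by (simp add: \<psi> matrix_vector_mul_assoc kron_mult)
  then have "\<psi> \<bullet> (kron (mat 1) \<Sigma>1 *v \<psi>) = 1 / (2 * real CARD('v)) *
      (\<Sum>i\<in>UNIV. \<Sum>j\<in>UNIV. (block ?f i - block ?f j) \<bullet> (\<Sigma>1 *v (block ?f i - block ?f j)))"
    unfolding \<psi> by (simp add: projected_inner[OF basis] block_kron_mat_1 matrix_vector_mult_diff_distrib)
  also have "\<dots> \<le> 1 / (2 * real CARD('v)) *
      (\<Sum>i\<in>UNIV. \<Sum>j\<in>UNIV. 2 * ((block ?f i - block ?f j) \<bullet> (block y i - block y j)))"
    by (intro mult_left_mono sum_mono) (auto simp: block_stacked_map intro: sector)
  also have "\<dots> = 2 * (\<psi> \<bullet> w)"
    unfolding \<psi> w projected_inner[OF basis] by (simp add: sum_distrib_left)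
  finally show ?thesis .
qed

section \<open>Multiplicative noise\<close>

lemma borel_measurable_vec_lambda:
  fixes f :: "'q::finite \<Rightarrow> 'w \<Rightarrow> real"
  assumes "\<And>k. f k \<in> borel_measurable M"
  shows "(\<lambda>w. \<chi> k. f k w) \<in> borel_measurable M"
  unfolding borel_measurable_euclidean_space[where 'c = "real^'q"]
  using assms by (auto simp: Basis_vec_def inner_axis)

text \<open>Restricting the noise family to the times before \<open>t\<close> makes explicit that \<open>x t\<close> depends on an index
  set disjoint from that of the noise at \<open>t\<close>; independence follows from this disjointness.\<close>

lemma state_is_function_of_past_noise:
  fixes \<xi> :: "'q::finite \<Rightarrow> nat \<Rightarrow> 'w \<Rightarrow> real"
    and x :: "nat \<Rightarrow> 'w \<Rightarrow> 'b::{second_countable_topology, topological_space}"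
  assumes x0: "\<And>w. w \<in> \<Omega> \<Longrightarrow> x 0 w = x0"
    and step: "\<And>t w. w \<in> \<Omega> \<Longrightarrow> x (Suc t) w = g t (\<chi> k. \<xi> k t w, x t w)"
    and g: "\<And>t. g t \<in> borel_measurable borel"
  shows "\<exists>f \<in> borel_measurable (PiM (UNIV \<times> {..<t}) (\<lambda>_. borel)).
    \<forall>w\<in>\<Omega>. x t w = f (restrict (\<lambda>p. \<xi> (fst p) (snd p) w) (UNIV \<times> {..<t}))"
proof (induction t)
  case 0
  show ?case
    by (intro bexI[of _ "\<lambda>_. x0"]) (auto simp: x0)
next
  case (Suc t)
  let ?I = "\<lambda>t. (UNIV :: 'q set) \<times> {..<t}"
  from Suc obtain f where f: "f \<in> borel_measurable (PiM (?I t) (\<lambda>_. borel))"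
    and xf: "\<And>w. w \<in> \<Omega> \<Longrightarrow> x t w = f (restrict (\<lambda>p. \<xi> (fst p) (snd p) w) (?I t))"
    by blast
  define f' where "f' h = g t (\<chi> k. h (k, t), f (restrict h (?I t)))" for h
  have "(\<lambda>h. f (restrict h (?I t))) \<in> borel_measurable (PiM (?I (Suc t)) (\<lambda>_. borel))"
    by (rule measurable_compose[OF measurable_restrict_subset f]) auto
  moreover have "(\<lambda>h. \<chi> k. h (k, t)) \<in> borel_measurable (PiM (?I (Suc t)) (\<lambda>_. borel :: real measure))"
    by (intro borel_measurable_vec_lambda measurable_component_singleton) auto
  ultimately have "(\<lambda>h. (\<chi> k. h (k, t), f (restrict h (?I t))))
      \<in> PiM (?I (Suc t)) (\<lambda>_. borel) \<rightarrow>\<^sub>M borel"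
    by (simp add: borel_prod[symmetric])
  then have "f' \<in> borel_measurable (PiM (?I (Suc t)) (\<lambda>_. borel))"
    unfolding f'_def using g by (rule measurable_compose)
  moreover have "x (Suc t) w = f' (restrict (\<lambda>p. \<xi> (fst p) (snd p) w) (?I (Suc t)))"
    if "w \<in> \<Omega>" for w
  proof -
    have "?I (Suc t) \<inter> ?I t = ?I t"
      by auto
    then show ?thesis
      using that by (simp add: f'_def step xf)
  qed
  ultimately show ?case
    by blast
qed

text \<open>The noise at time \<open>t\<close> and the noise before \<open>t\<close> are disjoint groups of an independent family. The
  recursion constrains \<open>x t\<close> on \<open>space M\<close> only, which is why independence is claimed for a random
  variable \<open>y\<close> that agrees with it there.\<close>

lemma (in prob_space) state_independent_of_current_noise:
  fixes \<xi> :: "'q::finite \<Rightarrow> nat \<Rightarrow> 'a \<Rightarrow> real"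
    and x :: "nat \<Rightarrow> 'a \<Rightarrow> 'b::{second_countable_topology, topological_space}"
  assumes indep: "indep_vars (\<lambda>_. borel) (\<lambda>(k, t). \<xi> k t) UNIV"
    and x0: "\<And>w. w \<in> space M \<Longrightarrow> x 0 w = x0"
    and step: "\<And>t w. w \<in> space M \<Longrightarrow> x (Suc t) w = g t (\<chi> k. \<xi> k t w, x t w)"
    and g: "\<And>t. g t \<in> borel_measurable borel"
  obtains y where "y \<in> borel_measurable M" "\<And>w. w \<in> space M \<Longrightarrow> x t w = y w"
    "\<And>p q. p \<in> borel_measurable borel \<Longrightarrow> q \<in> borel_measurable borel \<Longrightarrow>
      indep_var borel (\<lambda>w. p (\<chi> k. \<xi> k t w) :: real) borel (\<lambda>w. q (y w) :: real)"
proof -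
  let ?I = "(UNIV :: 'q set) \<times> {..<t}" and ?J = "(UNIV :: 'q set) \<times> {t}"
  let ?X = "\<lambda>I w. restrict (\<lambda>p. \<xi> (fst p) (snd p) w) I"
  from state_is_function_of_past_noise[of "space M" x x0 g \<xi> t, OF x0 step g]
  obtain f where f: "f \<in> borel_measurable (PiM ?I (\<lambda>_. borel))"
    and xf: "\<And>w. w \<in> space M \<Longrightarrow> x t w = f (?X ?I w)"
    by blast
  have ind: "indep_var (PiM ?J (\<lambda>_. borel)) (?X ?J) (PiM ?I (\<lambda>_. borel)) (?X ?I)"
    using indep_var_restrict[OF indep, of ?J ?I] by (auto simp: case_prod_beta)
  show thesis
  proof
    show "(\<lambda>w. f (?X ?I w)) \<in> borel_measurable M"
      by (rule measurable_compose[OF indep_var_rv2[OF ind] f])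
    show "x t w = f (?X ?I w)" if "w \<in> space M" for w
      using that by (rule xf)
    fix p :: "real^'q \<Rightarrow> real" and q :: "'b \<Rightarrow> real"
    assume p: "p \<in> borel_measurable borel" and q: "q \<in> borel_measurable borel"
    have "(\<lambda>h. \<chi> k. h (k, t)) \<in> borel_measurable (PiM ?J (\<lambda>_. borel :: real measure))"
      by (intro borel_measurable_vec_lambda measurable_component_singleton) auto
    from measurable_compose[OF this p] measurable_compose[OF f q]
    have "indep_var borel ((\<lambda>h. p (\<chi> k. h (k, t))) \<circ> ?X ?J) borel ((\<lambda>h. q (f h)) \<circ> ?X ?I)"
      by (rule indep_var_compose[OF ind])
    then show "indep_var borel (\<lambda>w. p (\<chi> k. \<xi> k t w)) borel (\<lambda>w. q (f (?X ?I w)))"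
      by (simp add: comp_def)
  qed
qed

lemma link_noise_moments:
  assumes "link_noise W \<xi> \<sigma>"
  shows "integrable W (\<xi> k t)" "integral\<^sup>L W (\<xi> k t) = 0"
    "integrable W (\<lambda>w. \<xi> k t w * \<xi> l t w)"
    "integral\<^sup>L W (\<lambda>w. \<xi> k t w * \<xi> l t w) = (if k = l then \<sigma>\<^sup>2 else 0)"
proof -
  interpret prob_space W
    using assms by (simp add: link_noise_def)
  have indep: "indep_vars (\<lambda>_. borel) (\<lambda>(k, t). \<xi> k t) UNIV"
    and sq: "\<And>k t. integrable W (\<lambda>w. (\<xi> k t w)\<^sup>2)" "\<And>k t. integral\<^sup>L W (\<lambda>w. (\<xi> k t w)\<^sup>2) = \<sigma>\<^sup>2"
    and mean: "\<And>k t. integral\<^sup>L W (\<xi> k t) = 0"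
    using assms by (auto simp: link_noise_def)
  have meas: "\<xi> k t \<in> borel_measurable W" for k t
    using indep by (auto simp: indep_vars_def)
  have int: "integrable W (\<xi> k t)" for k
    by (rule square_integrable_imp_integrable[OF meas sq(1)])
  show "integrable W (\<xi> k t)" "integral\<^sup>L W (\<xi> k t) = 0"
    using int mean by auto
  have ind: "indep_var borel (\<xi> k t) borel (\<xi> l t)" if "k \<noteq> l"
  proof -
    have "indep_var (PiM {(k, t)} (\<lambda>_. borel)) (\<lambda>w. restrict (\<lambda>p. \<xi> (fst p) (snd p) w) {(k, t)})
        (PiM {(l, t)} (\<lambda>_. borel)) (\<lambda>w. restrict (\<lambda>p. \<xi> (fst p) (snd p) w) {(l, t)})"
      using indep_var_restrict[OF indep, of "{(k, t)}" "{(l, t)}"] that by (auto simp: case_prod_beta)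
    from indep_var_compose[OF this, of "\<lambda>h. h (k, t)" borel "\<lambda>h. h (l, t)" borel]
    show ?thesis
      by (simp add: comp_def)
  qed
  show "integrable W (\<lambda>w. \<xi> k t w * \<xi> l t w)"
    using sq(1)[of k t] indep_var_integrable[OF ind int int]
    by (cases "k = l") (auto simp: power2_eq_square)
  show "integral\<^sup>L W (\<lambda>w. \<xi> k t w * \<xi> l t w) = (if k = l then \<sigma>\<^sup>2 else 0)"
    using sq(2)[of k t] indep_var_lebesgue_integral[OF ind int int] mean
    by (cases "k = l") (auto simp: power2_eq_square)
qed

lemma integrable_quadratic_form:
  fixes y :: "'w \<Rightarrow> real^'s" and X :: "real^'s^'s"
  assumes "y \<in> borel_measurable M" "integrable M (\<lambda>w. (norm (y w))\<^sup>2)"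
  shows "integrable M (\<lambda>w. y w \<bullet> (X *v y w))"
proof -
  obtain c where c: "c > 0" "\<And>v. \<bar>v \<bullet> (X *v v)\<bar> \<le> c * (norm v)\<^sup>2"
    using quadratic_form_upper_bound[of X] by blast
  show ?thesis
  proof (rule Bochner_Integration.integrable_bound)
    show "integrable M (\<lambda>w. c * (norm (y w))\<^sup>2)"
      using assms by simp
    have "(\<lambda>v. v \<bullet> (X *v v)) \<in> borel_measurable borel"
      by (intro borel_measurable_continuous_onI continuous_intros)
    from measurable_compose[OF assms(1) this]
    show "(\<lambda>w. y w \<bullet> (X *v y w)) \<in> borel_measurable M" .
    show "AE w in M. norm (y w \<bullet> (X *v y w)) \<le> norm (c * (norm (y w))\<^sup>2)"
      using c by auto
  qed
qed

text \<open>Expanding the form gives terms \<open>\<xi>\<^sub>k h(y)\<close> and \<open>\<xi>\<^sub>k \<xi>\<^sub>l h(y)\<close> with \<open>h\<close> quadratic. By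
  independence their means factor, so only the noise-free term and the diagonal \<open>k = l\<close> survive.\<close>

lemma (in prob_space) multiplicative_noise_second_moment:
  fixes y :: "'a \<Rightarrow> real^'s" and \<xi> :: "'q::finite \<Rightarrow> 'a \<Rightarrow> real"
    and Q :: "real^'d^'d" and F :: "real^'s^'d" and A :: "'q \<Rightarrow> real^'s^'d"
  assumes sym: "transpose Q = Q"
    and y: "y \<in> borel_measurable M" "integrable M (\<lambda>w. (norm (y w))\<^sup>2)"
    and indep: "\<And>p q. p \<in> borel_measurable borel \<Longrightarrow> q \<in> borel_measurable borel \<Longrightarrow>
      indep_var borel (\<lambda>w. p (\<chi> k. \<xi> k w) :: real) borel (\<lambda>w. q (y w) :: real)"
    and mean: "\<And>k. integrable M (\<xi> k)" "\<And>k. expectation (\<xi> k) = 0"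
    and cov: "\<And>k l. integrable M (\<lambda>w. \<xi> k w * \<xi> l w)"
      "\<And>k l. expectation (\<lambda>w. \<xi> k w * \<xi> l w) = (if k = l then v else 0)"
  defines "a \<equiv> \<lambda>w. F *v y w - (\<Sum>k\<in>UNIV. \<xi> k w *\<^sub>R (A k *v y w))"
  shows "integrable M (\<lambda>w. a w \<bullet> (Q *v a w))"
    and "expectation (\<lambda>w. a w \<bullet> (Q *v a w)) =
      expectation (\<lambda>w. (F *v y w) \<bullet> (Q *v (F *v y w)) +
        v * (\<Sum>k\<in>UNIV. (A k *v y w) \<bullet> (Q *v (A k *v y w))))"
proof -
  define h where "h X Y w = (X *v y w) \<bullet> (Q *v (Y *v y w))" for X Y :: "real^'s^'d" and w
  have form: "(X *v u) \<bullet> (Q *v (Y *v u)) = u \<bullet> ((transpose X ** Q ** Y) *v u)"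
    for X Y :: "real^'s^'d" and u
    using inner_matrix_vector_left[of u "transpose X" "Q *v (Y *v u)"]
    by (simp add: matrix_vector_mul_assoc matrix_mul_assoc del: transpose_matrix_vector)
  have int_h: "integrable M (h X Y)" for X Y
    unfolding h_def form by (rule integrable_quadratic_form[OF y])
  have meas_form: "(\<lambda>u. (X *v u) \<bullet> (Q *v (Y *v u))) \<in> borel_measurable borel" for X Y :: "real^'s^'d"
    unfolding form
    by (intro borel_measurable_continuous_onI continuous_intros)
  have meas_nth: "(\<lambda>x. x $ k) \<in> borel_measurable (borel :: (real^'q) measure)" for k
    by (intro borel_measurable_continuous_onI continuous_intros)
  have ind1: "indep_var borel (\<xi> k) borel (h X Y)" for k X Y
    using indep[OF meas_nth[of k] meas_form[of X Y]] by (simp add: h_def[abs_def])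
  have ind2: "indep_var borel (\<lambda>w. \<xi> k w * \<xi> l w) borel (h X Y)" for k l X Y
    using indep[OF borel_measurable_times[OF meas_nth[of k] meas_nth[of l]] meas_form[of X Y]]
    by (simp add: h_def[abs_def])
  have expand: "a w \<bullet> (Q *v a w) = h F F w - 2 * (\<Sum>k\<in>UNIV. \<xi> k w * h (A k) F w) +
      (\<Sum>k\<in>UNIV. \<Sum>l\<in>UNIV. (\<xi> k w * \<xi> l w) * h (A k) (A l) w)" for w
  proof -
    define b where "b = (\<Sum>k\<in>UNIV. \<xi> k w *\<^sub>R (A k *v y w))"
    have "a w \<bullet> (Q *v a w) = h F F w - 2 * (b \<bullet> (Q *v (F *v y w))) + b \<bullet> (Q *v b)"
      using inner_symmetric_matrix[OF sym, of "F *v y w" b]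
      by (simp add: a_def h_def matrix_vector_mult_diff_distrib inner_diff_left inner_diff_right
          inner_commute flip: b_def)
    moreover have "b \<bullet> (Q *v (F *v y w)) = (\<Sum>k\<in>UNIV. \<xi> k w * h (A k) F w)"
      by (simp add: b_def h_def inner_sum_left)
    moreover have "b \<bullet> (Q *v b) = (\<Sum>k\<in>UNIV. \<Sum>l\<in>UNIV. (\<xi> k w * \<xi> l w) * h (A k) (A l) w)"
      by (subst sum.swap) (simp add: b_def h_def inner_sum_left inner_sum_right
          linear_sum[OF matrix_vector_mul_linear] matrix_vector_mult_scaleR sum_distrib_left
          mult.assoc mult.left_commute)
    ultimately show ?thesis
      by simp
  qed
  note int1 = indep_var_integrable[OF ind1 mean(1) int_h]
  note int2 = indep_var_integrable[OF ind2 cov(1) int_h]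
  show "integrable M (\<lambda>w. a w \<bullet> (Q *v a w))"
    unfolding expand by (intro Bochner_Integration.integrable_add Bochner_Integration.integrable_diff
        integrable_mult_right Bochner_Integration.integrable_sum int_h int1 int2)
  have "expectation (\<lambda>w. a w \<bullet> (Q *v a w)) = expectation (h F F)
      - 2 * (\<Sum>k\<in>UNIV. expectation (\<lambda>w. \<xi> k w * h (A k) F w))
      + (\<Sum>k\<in>UNIV. \<Sum>l\<in>UNIV. expectation (\<lambda>w. (\<xi> k w * \<xi> l w) * h (A k) (A l) w))"
    unfolding expand using int_h int1 int2 by simp
  also have "\<dots> = expectation (h F F) + (\<Sum>k\<in>UNIV. v * expectation (h (A k) (A k)))"
    by (simp add: indep_var_lebesgue_integral[OF ind1 mean(1) int_h] mean(2)
        indep_var_lebesgue_integral[OF ind2 cov(1) int_h] cov(2) if_distribR if_distrib cong: if_cong)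
  also have "\<dots> = expectation (\<lambda>w. h F F w + v * (\<Sum>k\<in>UNIV. h (A k) (A k) w))"
    using int_h by (simp add: sum_distrib_left)
  finally show "expectation (\<lambda>w. a w \<bullet> (Q *v a w)) =
      expectation (\<lambda>w. (F *v y w) \<bullet> (Q *v (F *v y w)) +
        v * (\<Sum>k\<in>UNIV. (A k *v y w) \<bullet> (Q *v (A k *v y w))))"
    by (simp add: h_def)
qed

section \<open>Contraction of the networked system\<close>

lemma sum_scaleR_matrix_vector_mult:
  "(\<Sum>k\<in>K. c k *\<^sub>R X k) *v u = (\<Sum>k\<in>K. c k *\<^sub>R (X k *v u))" for X :: "'k \<Rightarrow> real^'b^'a"
  by (induction K rule: infinite_finite_induct)
     (simp_all add: matrix_vector_mult_add_rdistrib scaleR_matrix_vector_assoc)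

text \<open>The feedback of \<open>\<omega>\<close> through \<open>\<eta>\<close> is the random perturbation of the Laplacian, since
  \<open>\<Upsilon> \<Xi> \<Upsilon>\<^sup>T = (\<Sum>k. \<xi>\<^sub>k \<l>\<^sub>k \<l>\<^sub>k\<^sup>T)\<close>.\<close>

lemma noise_channel:
  "kron (Upsilon_hat U src dst) G *v (kron (diag_mat \<xi>) (mat 1) *v
      (kron (transpose (Upsilon_hat U src dst)) C *v z)) =
    (\<Sum>k\<in>UNIV. \<xi> k *\<^sub>R (A_link C G U src dst k *v z))"
proof -
  let ?Y = "Upsilon_hat U src dst" and ?l = "ell_hat U src dst"
  have "?Y ** diag_mat \<xi> ** transpose ?Y = (\<Sum>k\<in>UNIV. \<xi> k *\<^sub>R outer (?l k) (?l k))"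
    by (simp add: vec_eq_iff matrix_matrix_mult_def Upsilon_hat_def diag_mat_def transpose_def
        outer_def if_distrib mult.commute mult.left_commute cong: if_cong)
  then show ?thesis
    by (simp add: matrix_vector_mul_assoc matrix_mul_assoc kron_mult kron_sum_scaleR_left A_link_def
        flip: sum_scaleR_matrix_vector_mult)
qed

text \<open>Joint continuity in noise and state makes the transition map Borel, as needed to express the state
  through the past noise.\<close>

lemma network_step_continuous:
  fixes \<mu> :: "'v::finite \<Rightarrow> 'v \<Rightarrow> real" and src dst :: "'q::finite \<Rightarrow> 'v::finite"
    and A :: "real^'n^'n" and B :: "real^'m^'n" and C :: "real^'n^'m" and G :: "real^'m^'n"
  assumes "\<And>t. \<exists>L. L-lipschitz_on UNIV (\<lambda>y. \<phi> y t)"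
  shows "continuous_on UNIV (\<lambda>(v :: real^'q, x :: real^('v \<times> 'n)).
    (kron (mat 1) A - kron (uncertain_laplacian \<mu> src dst (\<lambda>k. v $ k)) (G ** C)) *v x
      - kron (mat 1) B *v stacked_map \<phi> t (kron (mat 1) C *v x))"
proof -
  let ?l = "\<lambda>k. link_vec (src k) (dst k)"
  have \<phi>: "continuous_on UNIV (\<lambda>y. \<phi> y t)"
    using assms lipschitz_on_continuous_on by blast
  have stacked: "continuous_on UNIV (stacked_map \<phi> t :: real^('v \<times> 'm) \<Rightarrow> _)"
    unfolding stacked_map_def
    by (intro continuous_intros continuous_on_compose2[OF \<phi>]) auto
  have "(kron (mat 1) A - kron (uncertain_laplacian \<mu> src dst (\<lambda>k. v $ k)) (G ** C)) *v x =
      kron (mat 1) A *v x - (kron (nominal_laplacian \<mu>) (G ** C) *v x +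
        (\<Sum>k\<in>UNIV. v $ k *\<^sub>R (kron (outer (?l k) (?l k)) (G ** C) *v x)))"
    for v :: "real^'q" and x :: "real^('v \<times> 'n)"
    unfolding uncertain_laplacian_def kron_add_left kron_sum_scaleR_left matrix_vector_mult_diff_rdistrib
      matrix_vector_mult_add_rdistrib sum_scaleR_matrix_vector_mult ..
  then show ?thesis
    unfolding case_prod_beta
    by (simp only:) (intro continuous_intros continuous_on_compose2[OF stacked]; auto)
qed

lemma M_mat_norm:
  "(norm (M_mat A B C G \<Sigma>1 \<mu> src dst U P *v u))\<^sup>2 =
    (\<Sum>k\<in>UNIV. (norm (mat_inv_sqrt (S_hat B \<Sigma>1 P) *v (A_link C G U src dst k *v
      (mat_inv_sqrt (TF_mat A B C G \<Sigma>1 \<mu> U P) *v u))))\<^sup>2)"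
proof -
  have "block (M_mat A B C G \<Sigma>1 \<mu> src dst U P *v u) k =
      (mat_inv_sqrt (S_hat B \<Sigma>1 P) ** A_link C G U src dst k **
        mat_inv_sqrt (TF_mat A B C G \<Sigma>1 \<mu> U P)) *v u" for k
    by (simp add: block_def M_mat_def matrix_vector_mult_def vec_eq_iff)
  then show ?thesis
    by (simp add: power2_norm_eq_inner inner_blocks matrix_vector_mul_assoc matrix_mul_assoc)
qed

text \<open>Apply the singular value bound to \<open>v = (T - F\<^sup>T S\<^sup>-\<^sup>1 F)\<^sup>1\<^sup>/\<^sup>2 u\<close>; both inverse square roots then
  cancel into quadratic forms.\<close>

lemma noise_gain_bound:
  fixes A :: "real^'n^'n" and P :: "real^('r::finite \<times> 'n)^('r \<times> 'n)"
    and src dst :: "'q::finite \<Rightarrow> 'v::finite"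
  assumes S: "pos_def (S_hat B \<Sigma>1 P)" and TF: "pos_def (TF_mat A B C G \<Sigma>1 \<mu> U P)"
  shows "(\<Sum>k\<in>UNIV. (A_link C G U src dst k *v u) \<bullet>
      (matrix_inv (S_hat B \<Sigma>1 P) *v (A_link C G U src dst k *v u)))
    \<le> (max_singular_value (M_mat A B C G \<Sigma>1 \<mu> src dst U P))\<^sup>2 *
      (u \<bullet> (TF_mat A B C G \<Sigma>1 \<mu> U P *v u))"
proof -
  let ?S = "S_hat B \<Sigma>1 P" and ?X = "TF_mat A B C G \<Sigma>1 \<mu> U P"
  define v where "v = mat_sqrt ?X *v u"
  have u: "mat_inv_sqrt ?X *v v = u"
    by (simp add: v_def matrix_vector_mul_assoc mat_inv_sqrt_pos_def[OF TF])
  have "(norm v)\<^sup>2 = u \<bullet> (?X *v u)"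
    using inner_symmetric_matrix[OF mat_sqrt_pos_def(1)[OF TF], of u v]
    by (simp add: v_def matrix_vector_mul_assoc mat_sqrt_pos_def[OF TF] power2_norm_eq_inner)
  moreover have "(norm (mat_inv_sqrt ?S *v b))\<^sup>2 = b \<bullet> (matrix_inv ?S *v b)" for b
    using inner_symmetric_matrix[OF mat_inv_sqrt_pos_def(2)[OF S], of b "mat_inv_sqrt ?S *v b"]
    by (simp add: matrix_vector_mul_assoc mat_inv_sqrt_pos_def[OF S] power2_norm_eq_inner)
  ultimately show ?thesis
    using norm_matrix_vector_le_max_singular_value[of "M_mat A B C G \<Sigma>1 \<mu> src dst U P" v]
    unfolding M_mat_norm u by simp
qed

text \<open>By the definitions of \<open>T\<close> and \<open>T - F\<^sup>T S\<^sup>-\<^sup>1 F\<close>, the left-hand side is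
  \<open>u \<bullet> P u - u \<bullet> (T - F\<^sup>T S\<^sup>-\<^sup>1 F) u\<close> plus the noise term, which costs at most the fraction
  \<open>\<sigma>\<^sup>2 \<rho>(M)\<^sup>2 < 1\<close> of the second form. What is left is bounded below by a multiple of \<open>u \<bullet> P u\<close>.\<close>

lemma lyapunov_contraction:
  fixes A :: "real^'n^'n" and C :: "real^'n^'m::finite"
    and P :: "real^('r::finite \<times> 'n)^('r \<times> 'n)"
    and src dst :: "'q::finite \<Rightarrow> 'v::finite"
  assumes P: "pos_def P" and S: "pos_def (S_hat B \<Sigma>1 P)" and TF: "pos_def (TF_mat A B C G \<Sigma>1 \<mu> U P)"
    and gain: "1 > \<sigma>\<^sup>2 * (max_singular_value (M_mat A B C G \<Sigma>1 \<mu> src dst U P))\<^sup>2"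
  defines "F \<equiv> F_mat A B C G \<Sigma>1 \<mu> U" and "Al \<equiv> A_link C G U src dst"
    and "Sinv \<equiv> matrix_inv (S_hat B \<Sigma>1 P)"
    and "Ch \<equiv> (kron (mat 1) C :: real^('r \<times> 'n)^('r \<times> 'm))"
    and "X \<equiv> (kron (mat 1) \<Sigma>1 :: real^('r \<times> 'm)^('r \<times> 'm))"
  obtains \<beta> where "0 < \<beta>" "\<beta> < 1"
    "\<And>u. (F *v u) \<bullet> (Sinv *v (F *v u)) + \<sigma>\<^sup>2 * (\<Sum>k\<in>UNIV. (Al k *v u) \<bullet> (Sinv *v (Al k *v u)))
      + (Ch *v u) \<bullet> (matrix_inv X *v (Ch *v u)) \<le> \<beta> * (u \<bullet> (P *v u))"
proof -
  define TF where "TF = TF_mat A B C G \<Sigma>1 \<mu> U P"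
  define \<rho> where "\<rho> = max_singular_value (M_mat A B C G \<Sigma>1 \<mu> src dst U P)"
  define \<delta> where "\<delta> = 1 - \<sigma>\<^sup>2 * \<rho>\<^sup>2"
  have \<delta>: "\<delta> > 0"
    using gain by (simp add: \<delta>_def \<rho>_def)
  obtain c where c: "c > 0" "\<And>v. c * (norm v)\<^sup>2 \<le> v \<bullet> (TF *v v)"
    using pos_def_lower_bound[OF TF] unfolding TF_def by blast
  obtain d where d: "d > 0" "\<And>v. \<bar>v \<bullet> (P *v v)\<bar> \<le> d * (norm v)\<^sup>2"
    using quadratic_form_upper_bound[of P] by blast
  \<comment> \<open>The contraction rate proper is \<open>1 - \<delta> c / d\<close>; the \<open>1/2\<close> only keeps \<open>\<beta>\<close> positive.\<close>
  define \<beta> where "\<beta> = max (1/2) (1 - \<delta> * c / d)"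
  have "(F *v u) \<bullet> (Sinv *v (F *v u)) + \<sigma>\<^sup>2 * (\<Sum>k\<in>UNIV. (Al k *v u) \<bullet> (Sinv *v (Al k *v u)))
      + (Ch *v u) \<bullet> (matrix_inv X *v (Ch *v u)) \<le> \<beta> * (u \<bullet> (P *v u))" for u
  proof -
    have TF_form: "u \<bullet> (TF *v u) = u \<bullet> (P *v u) - (Ch *v u) \<bullet> (matrix_inv X *v (Ch *v u))
        - (F *v u) \<bullet> (Sinv *v (F *v u))"
      using inner_matrix_vector_left[of u "transpose Ch"] inner_matrix_vector_left[of u "transpose F"]
      by (simp add: TF_def TF_mat_def T_hat_def matrix_vector_mult_diff_rdistrib inner_diff_right
          matrix_vector_mul_assoc[symmetric] F_def Sinv_def Ch_def X_def del: transpose_matrix_vector)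
    have "\<sigma>\<^sup>2 * (\<Sum>k\<in>UNIV. (Al k *v u) \<bullet> (Sinv *v (Al k *v u))) \<le> \<sigma>\<^sup>2 * (\<rho>\<^sup>2 * (u \<bullet> (TF *v u)))"
      unfolding Al_def Sinv_def \<rho>_def TF_def by (intro mult_left_mono noise_gain_bound[OF S TF]) simp
    moreover have "\<delta> * c / d * (u \<bullet> (P *v u)) \<le> \<delta> * (u \<bullet> (TF *v u))"
    proof -
      have "c / d * (u \<bullet> (P *v u)) \<le> c / d * (d * (norm u)\<^sup>2)"
        using c d(1) d(2)[of u] by (intro mult_left_mono) auto
      also have "\<dots> \<le> u \<bullet> (TF *v u)"
        using c d by simp
      finally have "\<delta> * (c / d * (u \<bullet> (P *v u))) \<le> \<delta> * (u \<bullet> (TF *v u))"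
        using \<delta> by (intro mult_left_mono) auto
      then show ?thesis
        by (simp add: mult.assoc)
    qed
    moreover have "(1 - \<delta> * c / d) * (u \<bullet> (P *v u)) \<le> \<beta> * (u \<bullet> (P *v u))"
      by (intro mult_right_mono pos_def_nonneg[OF P]) (simp add: \<beta>_def)
    ultimately show ?thesis
      unfolding TF_form \<delta>_def by (simp add: algebra_simps)
  qed
  moreover have "0 < \<beta>" "\<beta> < 1"
    using \<delta> c d by (auto simp: \<beta>_def)
  ultimately show thesis
    using that by blast
qed

theorem theorem13:
  fixes W :: "'w measure"
    and A :: "real^'n^'n" and B :: "real^'m^'n" and C :: "real^'n^'m" and G :: "real^'m^'n"
    and D D1 \<Sigma>1 :: "real^'m^'m"
    and \<phi> :: "real^'m \<Rightarrow> nat \<Rightarrow> real^'m"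
    and \<mu> :: "'v::finite \<Rightarrow> 'v \<Rightarrow> real"
    and src dst :: "'q::finite \<Rightarrow> 'v"
    and \<xi> :: "'q \<Rightarrow> nat \<Rightarrow> 'w \<Rightarrow> real" and \<sigma> :: real
    and U :: "real^'r^'v"
    and P :: "real^('r \<times> 'n)^('r \<times> 'n)"
  assumes \<Sigma>1_def: "\<Sigma>1 = D1 + transpose D1"
    and "pos_def \<Sigma>1"
    and "admissible_nonlinearity \<phi> D D1"
    and "network \<mu> src dst"
    and "laplacian_eigenbasis \<mu> U"
    and "link_noise W \<xi> \<sigma>"
    and "pos_def P"
    and "pos_def (kron (mat 1) \<Sigma>1 - transpose (kron (mat 1) B) ** P ** kron (mat 1) B)"
    and "pos_def (S_hat B \<Sigma>1 P)"
    and "pos_def (TF_mat A B C G \<Sigma>1 \<mu> U P)"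
    and "1 > \<sigma>\<^sup>2 * (max_singular_value (M_mat A B C G \<Sigma>1 \<mu> src dst U P))\<^sup>2"
  shows "mean_square_exp_stable W (io_solutions W A B C G \<Sigma>1 \<phi> \<mu> src dst U \<xi>)"
proof -
  interpret prob_space W
    using assms(6) by (simp add: link_noise_def)
  let ?Bh = "kron (mat 1) B :: real^('r \<times> 'm)^('r \<times> 'n)"
  let ?Ch = "kron (mat 1) C :: real^('r \<times> 'n)^('r \<times> 'm)"
  let ?X = "kron (mat 1) \<Sigma>1 :: real^('r \<times> 'm)^('r \<times> 'm)"
  let ?K = "kron (transpose U) (mat 1) :: real^('v \<times> 'n)^('r \<times> 'n)"
  let ?S = "S_hat B \<Sigma>1 P" and ?F = "F_mat A B C G \<Sigma>1 \<mu> U" and ?Al = "A_link C G U src dst"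
  have X: "pos_def ?X"
    by (rule pos_def_kron_mat_1) fact
  have S: "pos_def ?S" and P: "pos_def P"
    by fact+
  obtain \<beta> where \<beta>: "0 < \<beta>" "\<beta> < 1"
    and contraction: "\<And>u. (?F *v u) \<bullet> (matrix_inv ?S *v (?F *v u))
      + \<sigma>\<^sup>2 * (\<Sum>k\<in>UNIV. (?Al k *v u) \<bullet> (matrix_inv ?S *v (?Al k *v u)))
      + (?Ch *v u) \<bullet> (matrix_inv ?X *v (?Ch *v u)) \<le> \<beta> * (u \<bullet> (P *v u))"
    by (rule lyapunov_contraction[OF assms(7,9,10,11)]) (rule that, assumption+)
  obtain c where c: "c > 0" "\<And>v. c * (norm v)\<^sup>2 \<le> v \<bullet> (P *v v)"
    using pos_def_lower_bound[OF P] by blast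
  obtain d where d: "d > 0" "\<And>v. \<bar>v \<bullet> (P *v v)\<bar> \<le> d * (norm v)\<^sup>2"
    using quadratic_form_upper_bound[of P] by blast
  have decay: "integrable W (\<lambda>w. (norm (z t w))\<^sup>2) \<and>
      expectation (\<lambda>w. (norm (z t w))\<^sup>2) \<le> d / c * \<beta> ^ t * (norm z0)\<^sup>2"
    if z: "z \<in> io_solutions W A B C G \<Sigma>1 \<phi> \<mu> src dst U \<xi>"
      and z0: "\<forall>w\<in>space W. z 0 w = z0" for z z0 t
  proof -
    obtain x \<psi> y \<omega> \<nu> \<eta> where traj: "network_trajectory W A B C G \<phi> \<mu> src dst \<xi> x"
      and zx: "\<And>t w. w \<in> space W \<Longrightarrow> z t w = ?K *v x t w"
      and \<psi>: "\<And>t w. w \<in> space W \<Longrightarrow> \<psi> t w = kron (transpose U) (mat 1) *v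
          stacked_map \<phi> t (kron (mat 1) C *v x t w)"
      and io: "io_system W A B C G \<Sigma>1 \<mu> src dst U \<xi> \<psi> z y \<omega> \<nu> \<eta>"
      using z unfolding io_solutions_def by blast
    obtain x0 where x0: "\<And>w. w \<in> space W \<Longrightarrow> x 0 w = x0"
      using traj unfolding network_trajectory_def by blast
    define g where "g t = (\<lambda>(v :: real^'q, x :: real^('v \<times> 'n)).
      (kron (mat 1) A - kron (uncertain_laplacian \<mu> src dst (\<lambda>k. v $ k)) (G ** C)) *v x
        - kron (mat 1) B *v stacked_map \<phi> t (kron (mat 1) C *v x))" for t
    have step: "x (Suc t) w = g t (\<chi> k. \<xi> k t w, x t w)" if "w \<in> space W" for t w
      using traj that unfolding network_trajectory_def by (simp add: g_def uncertain_laplacian_def)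
    have g: "g t \<in> borel_measurable borel" for t
      unfolding g_def using assms(3)
      by (intro borel_measurable_continuous_onI network_step_continuous)
         (simp add: admissible_nonlinearity_def)
    have noise_indep: "indep_vars (\<lambda>_. borel) (\<lambda>(k, t). \<xi> k t) UNIV"
      using assms(6) by (simp add: link_noise_def)
    \<comment> \<open>The processes are constrained on \<open>space W\<close> only, so measurability and independence are
      stated for a copy of \<open>z t\<close> that is a function of the past noise everywhere.\<close>
    have version: "\<exists>y. y \<in> borel_measurable W \<and> (\<forall>w\<in>space W. z t w = y w) \<and>
        (\<forall>p\<in>borel_measurable borel. \<forall>q\<in>borel_measurable borel.
          indep_var borel (\<lambda>w. p (\<chi> k. \<xi> k t w) :: real) borel (\<lambda>w. q (y w) :: real))" for t
    proof -
      obtain y where y: "y \<in> borel_measurable W" "\<And>w. w \<in> space W \<Longrightarrow> x t w = y w"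
        "\<And>p q. p \<in> borel_measurable borel \<Longrightarrow> q \<in> borel_measurable borel \<Longrightarrow>
          indep_var borel (\<lambda>w. p (\<chi> k. \<xi> k t w) :: real) borel (\<lambda>w. q (y w) :: real)"
        using state_independent_of_current_noise[where t = t, OF noise_indep x0 step g] by blast
      have K: "(*v) ?K \<in> borel_measurable borel"
        by (intro borel_measurable_continuous_onI continuous_intros)
      show ?thesis
        by (intro exI[of _ "\<lambda>w. ?K *v y w"] conjI ballI measurable_compose[OF y(1) K]
            y(3)[OF _ measurable_compose[OF K]])
           (auto simp: zx y(2))
    qed
    have "integrable W (\<lambda>w. (norm (z t w))\<^sup>2) \<and>
      expectation (\<lambda>w. z t w \<bullet> (P *v z t w)) \<le> \<beta> ^ t * (z0 \<bullet> (P *v z0))"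
    proof (induction t)
      case 0
      have "integrable W (\<lambda>w. (norm (z 0 w))\<^sup>2) \<longleftrightarrow> integrable W (\<lambda>w. (norm z0)\<^sup>2)"
        using z0 by (intro Bochner_Integration.integrable_cong) auto
      moreover have "expectation (\<lambda>w. z 0 w \<bullet> (P *v z 0 w)) = expectation (\<lambda>w. z0 \<bullet> (P *v z0))"
        using z0 by (intro Bochner_Integration.integral_cong) auto
      ultimately show ?case
        by (simp add: prob_space)
    next
      case (Suc t)
      obtain u where u: "u \<in> borel_measurable W" "\<And>w. w \<in> space W \<Longrightarrow> z t w = u w"
        and ind: "\<And>p q. p \<in> borel_measurable borel \<Longrightarrow> q \<in> borel_measurable borel \<Longrightarrow>
          indep_var borel (\<lambda>w. p (\<chi> k. \<xi> k t w) :: real) borel (\<lambda>w. q (u w) :: real)"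
        using version[of t] by blast
      obtain u' where u': "u' \<in> borel_measurable W" "\<And>w. w \<in> space W \<Longrightarrow> z (Suc t) w = u' w"
        using version[of "Suc t"] by blast
      have "integrable W (\<lambda>w. (norm (z t w))\<^sup>2) \<longleftrightarrow> integrable W (\<lambda>w. (norm (u w))\<^sup>2)"
        using u(2) by (intro Bochner_Integration.integrable_cong) auto
      then have int_u: "integrable W (\<lambda>w. (norm (u w))\<^sup>2)"
        using Suc by blast
      define a where "a w = ?F *v u w - (\<Sum>k\<in>UNIV. \<xi> k t w *\<^sub>R (?Al k *v u w))" for w
      define s where "s w = (?Ch *v u w) \<bullet> (matrix_inv ?X *v (?Ch *v u w))" for w
      \<comment> \<open>A bound for each outcome, before averaging; its right-hand side depends on the state and the
        current noise only, so the nonlinearity has been eliminated.\<close>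
      have bound: "u' w \<bullet> (P *v u' w) \<le> a w \<bullet> (matrix_inv ?S *v a w) + s w" if w: "w \<in> space W" for w
      proof -
        from io w have z': "z (Suc t) w = ?F *v z t w - kron (Upsilon_hat U src dst) G *v \<eta> t w
            + ?Bh *v \<nu> t w"
          and \<nu>: "\<nu> t w = matrix_inv ?X *v (?Ch *v z t w) - \<psi> t w"
          and \<eta>: "\<eta> t w = kron (diag_mat (\<lambda>k. \<xi> k t w)) (mat 1) *v
            (kron (transpose (Upsilon_hat U src dst)) C *v z t w)"
          unfolding io_system_def by auto
        have step_z: "u' w = a w + ?Bh *v \<nu> t w"
          using z' unfolding \<eta> noise_channel by (simp add: a_def u(2) u'(2) w)
        have "u' w \<bullet> (P *v u' w) \<le> a w \<bullet> (matrix_inv ?S *v a w) + \<nu> t w \<bullet> (?X *v \<nu> t w)"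
          unfolding step_z S_hat_def
          by (rule lyapunov_step_bound[OF P X]) (use S in \<open>simp add: S_hat_def\<close>)
        moreover have "\<nu> t w \<bullet> (?X *v \<nu> t w) \<le> s w"
        proof -
          have Cz: "?Ch *v u w = kron (transpose U) (mat 1) *v (kron (mat 1) C *v x t w)"
            unfolding u(2)[OF w, symmetric] zx[OF w]
            by (simp add: matrix_vector_mul_assoc kron_mult)
          show ?thesis
            unfolding \<nu> s_def u(2)[OF w]
            by (rule loop_transformed_sector_bound[OF X])
               (rule stacked_sector_bound[OF assms(1,3,5) \<psi>[OF w] Cz])
        qed
        ultimately show ?thesis
          by linarith
      qed
      note moments = link_noise_moments[OF assms(6), where t = t]
      let ?q = "\<lambda>w. (?F *v u w) \<bullet> (matrix_inv ?S *v (?F *v u w)) +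
          \<sigma>\<^sup>2 * (\<Sum>k\<in>UNIV. (?Al k *v u w) \<bullet> (matrix_inv ?S *v (?Al k *v u w)))"
      have int_a: "integrable W (\<lambda>w. a w \<bullet> (matrix_inv ?S *v a w))"
        and mean_a: "expectation (\<lambda>w. a w \<bullet> (matrix_inv ?S *v a w)) = expectation ?q"
        unfolding a_def
        by (rule multiplicative_noise_second_moment[OF pos_def_inverse(3)[OF S] u(1) int_u ind moments],
            assumption+)+
      have s_form: "s w = u w \<bullet> ((transpose ?Ch ** matrix_inv ?X ** ?Ch) *v u w)" for w
        using inner_matrix_vector_left[of "u w" "transpose ?Ch"]
        by (simp add: s_def matrix_vector_mul_assoc[symmetric] del: transpose_matrix_vector)
      have int_s: "integrable W s"
        unfolding s_form[abs_def] by (rule integrable_quadratic_form[OF u(1) int_u])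
      have meas_form: "(\<lambda>v. v \<bullet> (P *v v)) \<in> borel_measurable borel"
        by (intro borel_measurable_continuous_onI continuous_intros)
      have int_V: "integrable W (\<lambda>w. u' w \<bullet> (P *v u' w))"
      proof (rule Bochner_Integration.integrable_bound)
        show "integrable W (\<lambda>w. a w \<bullet> (matrix_inv ?S *v a w) + s w)"
          by (intro Bochner_Integration.integrable_add int_a int_s)
        show "(\<lambda>w. u' w \<bullet> (P *v u' w)) \<in> borel_measurable W"
          by (rule measurable_compose[OF u'(1) meas_form])
        show "AE w in W. norm (u' w \<bullet> (P *v u' w)) \<le> norm (a w \<bullet> (matrix_inv ?S *v a w) + s w)"
        proof (rule AE_I2)
          fix w assume "w \<in> space W"
          from bound[OF this] pos_def_nonneg[OF P, of "u' w"]
          show "norm (u' w \<bullet> (P *v u' w)) \<le> norm (a w \<bullet> (matrix_inv ?S *v a w) + s w)"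
            by simp
        qed
      qed
      have "integrable W (\<lambda>w. (norm (u' w))\<^sup>2)"
      proof (rule Bochner_Integration.integrable_bound)
        show "integrable W (\<lambda>w. u' w \<bullet> (P *v u' w) / c)"
          using int_V by simp
        show "(\<lambda>w. (norm (u' w))\<^sup>2) \<in> borel_measurable W"
          using u'(1) by measurable
        show "AE w in W. norm ((norm (u' w))\<^sup>2) \<le> norm (u' w \<bullet> (P *v u' w) / c)"
          using c pos_def_nonneg[OF P] by (intro AE_I2) (simp add: pos_le_divide_eq mult.commute)
      qed
      moreover have "integrable W (\<lambda>w. (norm (z (Suc t) w))\<^sup>2) \<longleftrightarrow> integrable W (\<lambda>w. (norm (u' w))\<^sup>2)"
        using u'(2) by (intro Bochner_Integration.integrable_cong) auto
      moreover have "expectation (\<lambda>w. z (Suc t) w \<bullet> (P *v z (Suc t) w)) \<le> \<beta> ^ Suc t * (z0 \<bullet> (P *v z0))"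
      proof -
        have form: "(Y *v v) \<bullet> (matrix_inv ?S *v (Y *v v)) = v \<bullet> ((transpose Y ** matrix_inv ?S ** Y) *v v)"
          for Y :: "real^('r \<times> 'n)^('r \<times> 'n)" and v
          using inner_matrix_vector_left[of v "transpose Y"]
          by (simp add: matrix_vector_mul_assoc[symmetric] del: transpose_matrix_vector)
        have int_q: "integrable W ?q"
          unfolding form by (intro Bochner_Integration.integrable_add integrable_mult_right
              Bochner_Integration.integrable_sum integrable_quadratic_form[OF u(1) int_u])
        have "expectation (\<lambda>w. z (Suc t) w \<bullet> (P *v z (Suc t) w)) = expectation (\<lambda>w. u' w \<bullet> (P *v u' w))"
          using u'(2) by (intro Bochner_Integration.integral_cong) auto
        also have "\<dots> \<le> expectation (\<lambda>w. a w \<bullet> (matrix_inv ?S *v a w) + s w)"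
          by (intro integral_mono int_V Bochner_Integration.integrable_add int_a int_s bound)
        also have "\<dots> = expectation ?q + expectation s"
          unfolding mean_a[symmetric] by (rule Bochner_Integration.integral_add[OF int_a int_s])
        also have "\<dots> = expectation (\<lambda>w. ?q w + s w)"
          by (rule Bochner_Integration.integral_add[OF int_q int_s, symmetric])
        also have "\<dots> \<le> expectation (\<lambda>w. \<beta> * (u w \<bullet> (P *v u w)))"
          using contraction
          by (intro integral_mono Bochner_Integration.integrable_add int_q int_s integrable_mult_right
              integrable_quadratic_form[OF u(1) int_u]) (simp only: s_def)
        also have "\<dots> = \<beta> * expectation (\<lambda>w. u w \<bullet> (P *v u w))"
          by simp
        also have "expectation (\<lambda>w. u w \<bullet> (P *v u w)) = expectation (\<lambda>w. z t w \<bullet> (P *v z t w))"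
          using u(2) by (intro Bochner_Integration.integral_cong) auto
        also have "\<beta> * \<dots> \<le> \<beta> * (\<beta> ^ t * (z0 \<bullet> (P *v z0)))"
          using Suc \<beta> by (intro mult_left_mono) auto
        finally show ?thesis
          by (simp add: mult.assoc)
      qed
      ultimately show ?case
        by blast
    qed
    then have int: "integrable W (\<lambda>w. (norm (z t w))\<^sup>2)"
      and V: "expectation (\<lambda>w. z t w \<bullet> (P *v z t w)) \<le> \<beta> ^ t * (z0 \<bullet> (P *v z0))"
      by auto
    obtain u where u: "u \<in> borel_measurable W" "\<And>w. w \<in> space W \<Longrightarrow> z t w = u w"
      using version[of t] by blast
    have "integrable W (\<lambda>w. (norm (z t w))\<^sup>2) \<longleftrightarrow> integrable W (\<lambda>w. (norm (u w))\<^sup>2)"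
      using u(2) by (intro Bochner_Integration.integrable_cong) auto
    then have int_u: "integrable W (\<lambda>w. (norm (u w))\<^sup>2)"
      using int by blast
    have int_V: "integrable W (\<lambda>w. z t w \<bullet> (P *v z t w)) \<longleftrightarrow> integrable W (\<lambda>w. u w \<bullet> (P *v u w))"
      using u(2) by (intro Bochner_Integration.integrable_cong) auto
    have "c * expectation (\<lambda>w. (norm (z t w))\<^sup>2) = expectation (\<lambda>w. c * (norm (z t w))\<^sup>2)"
      by simp
    also have "\<dots> \<le> expectation (\<lambda>w. z t w \<bullet> (P *v z t w))"
      using int int_V integrable_quadratic_form[OF u(1) int_u] c(2) by (intro integral_mono) auto
    also have "\<dots> \<le> \<beta> ^ t * (z0 \<bullet> (P *v z0))"
      by (rule V)
    also have "\<dots> \<le> \<beta> ^ t * (d * (norm z0)\<^sup>2)"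
      using d(2)[of z0] \<beta> by (intro mult_left_mono) auto
    finally show ?thesis
      using int c(1) by (simp add: field_simps)
  qed
  have "d / c > 0"
    using c d by simp
  then show ?thesis
    unfolding mean_square_exp_stable_def using \<beta> decay by blast
qed

end
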